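(* Let $\mathbb{F}$ be a field of characteristic $0$, let $k\ge3$ be odd, let $\vec d=(d_1,\dots,d_k)$ be an odd-symmetric sequence of positive integers (not necessarily with $d_1=1$), set $d=d_1+\cdots+d_k$, and let $S=(S(1),\dots,S(k-1))$ be a sequence of matrices with $S(i)\in M_{d_i\times d_{i+1}}(\mathbb{F})$ and $S(i)_{d_i,1}\neq0$ for all $i$. Assume that $S$ is weakly normalized. Then $A_{1,d}=0$ for all $A\in\mathfrak{n}(S)$ if and only if $S$ is $\phi$-invariant.
   Context: Matrices in $\mathfrak{gl}(d)=\mathfrak{gl}(d,\mathbb{F})$ are partitioned into blocks according to $\vec d$. $\vec d$ is odd-symmetric if $d_i=d_{k+1-i}$ for all $i$, $k$ is odd and $d_{(k+1)/2}$ is odd. $J^p(0)$ is the upper triangular nilpotent Jordan block of size $p$. $D(0,0)=J^{d_1}(0)\oplus\cdots\oplus J^{d_k}(0)$. $E(S)\in\mathfrak{gl}(d)$ is the block matrix whose $(i,i+1)$ block is $S(i)$, $1\le i\le k-1$, and all of whose other blocks are $0$. $\mathfrak{n}(S)$ is the Lie subalgebra of $\mathfrak{gl}(d)$ generated by all $(\mathrm{ad}\,D(0,0))^lE(S)$, $l\ge0$. $S$ is weakly normalized if: (i) $S(i)_{d_i,1}=1$ for $1\le i\le k-1$; and (ii) $S(i)_{d_i,j}=S(i+1)_{d_{i+1}+1-j,1}$ for $1\le j\le d_{i+1}$ and $1\le i\le k-2$. $S$ is $\phi$-invariant if $\phi(E(S))=E(S)$, where $\phi:\mathfrak{gl}(d)\to\mathfrak{gl}(d)$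 is the automorphism $\phi(A)_{i,j}=(-1)^{i-j+1}A_{d+1-j,d+1-i}$. *)

theory Defs
  imports "Jordan_Normal_Form.Jordan_Normal_Form"
begin

(* A sequence d_1, ..., d_k is a function d :: nat => nat read on {1..k}, and S(1), ..., S(k-1)
   is a function read on {1..k-1}. Values outside these ranges are never used. *)

(* Library matrices are indexed from 0; entry A i j is the (i,j) entry counted from 1,
   meant for i, j >= 1. *)
abbreviation entry :: "'a mat \<Rightarrow> nat \<Rightarrow> nat \<Rightarrow> 'a" where
  "entry A i j \<equiv> A $$ (i - 1, j - 1)"

definition offset :: "(nat \<Rightarrow> nat) \<Rightarrow> nat \<Rightarrow> nat" where
  "offset d p = (\<Sum>i\<in>{1..<p}. d i)"

definition dim_total :: "nat \<Rightarrow> (nat \<Rightarrow> nat) \<Rightarrow> nat" where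
  "dim_total k d = (\<Sum>i\<in>{1..k}. d i)"

definition odd_symmetric :: "nat \<Rightarrow> (nat \<Rightarrow> nat) \<Rightarrow> bool" where
  "odd_symmetric k d \<longleftrightarrow>
     (\<forall>i\<in>{1..k}. d i = d (k + 1 - i)) \<and> odd k \<and> odd (d ((k + 1) div 2))"

definition D00 :: "nat \<Rightarrow> (nat \<Rightarrow> nat) \<Rightarrow> 'a::field mat" where
  "D00 k d = jordan_matrix (map (\<lambda>i. (d i, 0)) [1..<k + 1])"

(* The block (counted from 1) containing the row or column r, where r is counted from 0. *)
definition block_of :: "(nat \<Rightarrow> nat) \<Rightarrow> nat \<Rightarrow> nat" where
  "block_of d r = (THE p. 1 \<le> p \<and> offset d p \<le> r \<and> r < offset d p + d p)"

definition E_mat :: "nat \<Rightarrow> (nat \<Rightarrow> nat) \<Rightarrow> (nat \<Rightarrow> 'a mat) \<Rightarrow> 'a::field mat" where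
  "E_mat k d S = mat (dim_total k d) (dim_total k d)
     (\<lambda>(r, c). let p = block_of d r; q = block_of d c
               in if q = p + 1 then S p $$ (r - offset d p, c - offset d q) else 0)"

lemma offset_Suc: "1 \<le> p \<Longrightarrow> offset d (Suc p) = offset d p + d p"
  by (simp add: offset_def atLeastLessThanSuc)

lemma offset_mono: "p \<le> q \<Longrightarrow> offset d p \<le> offset d q"
  unfolding offset_def by (rule sum_mono2) auto

lemma block_of_offset:
  assumes "1 \<le> p" "a < d p"
  shows "block_of d (offset d p + a) = p"
  unfolding block_of_def
proof (rule the_equality)
  show "1 \<le> p \<and> offset d p \<le> offset d p + a \<and> offset d p + a < offset d p + d p"
    using assms by simp
next
  fix q assume q: "1 \<le> q \<and> offset d q \<le> offset d p + a \<and> offset d p + a < offset d q + d q"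
  show "q = p"
  proof (rule linorder_cases[of p q])
    assume "p < q"
    with offset_mono[of "Suc p" q d] offset_Suc[OF assms(1), of d] q assms show ?thesis by simp
  next
    assume "q < p"
    with offset_mono[of "Suc q" p d] offset_Suc[of q d] q assms show ?thesis by simp
  qed simp
qed

lemma E_mat_block:
  assumes "p \<in> {1..k}" "q \<in> {1..k}" "a < d p" "b < d q"
  shows "E_mat k d S $$ (offset d p + a, offset d q + b) = (if q = p + 1 then S p $$ (a, b) else 0)"
proof -
  have "offset d r + x < dim_total k d" if "r \<in> {1..k}" "x < d r" for r x
  proof -
    have "offset d (Suc k) = dim_total k d"
      unfolding offset_def dim_total_def by (simp add: atLeastLessThanSuc_atLeastAtMost)
    with offset_mono[of "Suc r" "Suc k" d] offset_Suc[of r d] that show ?thesis by simp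
  qed
  then have "offset d p + a < dim_total k d" "offset d q + b < dim_total k d"
    using assms by blast+
  moreover have "block_of d (offset d p + a) = p" "block_of d (offset d q + b) = q"
    using assms by (simp_all add: block_of_offset)
  ultimately show ?thesis
    unfolding E_mat_def by (simp only: index_mat split_conv Let_def add_diff_cancel_left')
qed

definition lie_bracket :: "'a::field mat \<Rightarrow> 'a mat \<Rightarrow> 'a mat" where
  "lie_bracket A B = A * B - B * A"

definition lie_subalgebra :: "nat \<Rightarrow> 'a::field mat set \<Rightarrow> bool" where
  "lie_subalgebra n L \<longleftrightarrow>
     L \<subseteq> carrier_mat n n \<and> 0\<^sub>m n n \<in> L \<and>
     (\<forall>A\<in>L. \<forall>B\<in>L. A + B \<in> L) \<and>
     (\<forall>c. \<forall>A\<in>L. c \<cdot>\<^sub>m A \<in> L) \<and>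
     (\<forall>A\<in>L. \<forall>B\<in>L. lie_bracket A B \<in> L)"

definition n_alg :: "nat \<Rightarrow> (nat \<Rightarrow> nat) \<Rightarrow> (nat \<Rightarrow> 'a mat) \<Rightarrow> 'a::field mat set" where
  "n_alg k d S =
     lie_subalgebra (dim_total k d) hull range (\<lambda>l. (lie_bracket (D00 k d) ^^ l) (E_mat k d S))"

definition weakly_normalized ::
    "nat \<Rightarrow> (nat \<Rightarrow> nat) \<Rightarrow> (nat \<Rightarrow> 'a::field mat) \<Rightarrow> bool" where
  "weakly_normalized k d S \<longleftrightarrow>
     (\<forall>i\<in>{1..k - 1}. entry (S i) (d i) 1 = 1) \<and>
     (\<forall>i\<in>{1..k - 2}. \<forall>j\<in>{1..d (i + 1)}.
        entry (S i) (d i) j = entry (S (i + 1)) (d (i + 1) + 1 - j) 1)"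

(* With i = r + 1 and j = c + 1 this is
   \<phi>(A)_{i,j} = (-1)^{i-j+1} A_{n+1-j, n+1-i}. *)
definition phi :: "nat \<Rightarrow> 'a::field mat \<Rightarrow> 'a mat" where
  "phi n A = mat n n (\<lambda>(r, c). let i = r + 1; j = c + 1 in
     (- 1) powi (int i - int j + 1) * entry A (n + 1 - j) (n + 1 - i))"

definition phi_invariant ::
    "nat \<Rightarrow> (nat \<Rightarrow> nat) \<Rightarrow> (nat \<Rightarrow> 'a::field mat) \<Rightarrow> bool" where
  "phi_invariant k d S \<longleftrightarrow> phi (dim_total k d) (E_mat k d S) = E_mat k d S"

end

theory Submission
  imports Defs
begin

text \<open>
  Since \<open>n(S)\<close> is the ideal generated by \<open>E = E(S)\<close> in the Lie algebra generated by \<open>D = D(0,0)\<close> and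
  \<open>E\<close>, the condition says that the functional \<open>F(w) = (w(D,E))\<^sub>1\<^sub>d\<close> on words in two letters vanishes on all Lie
  polynomials. The map \<open>\<phi>\<close> is a Lie automorphism fixing \<open>D\<close> which acts on the \<open>(1,d)\<close> entry as
  \<open>-1\<close>; this gives one direction.

  For the other, \<open>D\<close> and \<open>E\<close> have complementary superdiagonals, recorded by a palindromic word \<open>W\<close> of
  even length \<open>d - 1\<close>: the entry \<open>w(D,E)\<^sub>1\<^sub>d\<close> of a word of full length is \<open>1\<close> if \<open>w = W\<close> and \<open>0\<close> otherwise. Let
  \<open>\<delta>\<close> be the least distance from the superdiagonal at which \<open>E\<close> and \<open>\<phi>(E)\<close> differ. On words of
  length \<open>d - 1 - \<delta>\<close>, the difference of the functionals of \<open>(D,E)\<close> and \<open>(D,\<phi>(E))\<close> is a combination of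
  indicators of words obtained from \<open>W\<close> by replacing one factor \<open>D\<^sup>p E D\<^sup>q\<close>, \<open>p + q = \<delta>\<close>, by \<open>E\<close>; weak
  normalization ensures that equal words carry equal coefficients. Such a combination cannot vanish on
  Lie polynomials unless it is zero. This is shown by stripping the outer runs of \<open>W\<close> with \<open>ad(D)\<close>
  and \<open>ad(E)\<close>, and by the theorem of Duchamp and Thibon that only powers of letters and palindromes of
  even length are missing from the support of the free Lie algebra.
\<close>

section \<open>Functionals vanishing on Lie polynomials\<close>

text \<open>Reversal is built into the problem. A Lie polynomial of degree r is an eigenvector of
  reversal with sign (-1)^(r-1), so F and w -> (-1)^|w| F(rev w) take opposite values on it. The
  second functional is the corner functional of the pair (D, phi(E)). Hence the difference of the
  two still vanishes on Lie polynomials, and it measures E - phi(E). The obstacle is cancellation.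
  Bracketing with a letter spreads it over both ends of a word, so a word and its reverse, or two
  different deformations, may feed the same coefficient. Every stripping below is therefore chosen
  so that a single word, up to reversal, survives. Even palindromes must be avoided as the surviving
  word, and W itself is one. Parity helps: W contains E an even number of times and deformations
  keep that number, so removing one E leaves an odd number, which no even palindrome has.
  Characteristic 0 enters through nonzero binomial coefficients, through 2, and through the number
  of equal deformed words.\<close>

text \<open>\<open>br h x\<close> is the transpose of \<open>P \<mapsto> [P, x]\<close>: a functional \<open>h\<close> on words is evaluated on
  the left-normed bracket \<open>[\<dots>[[x, y\<^sub>1], y\<^sub>2], \<dots>, y\<^sub>r]\<close> by folding \<open>br\<close> over \<open>[y\<^sub>r, \<dots>, y\<^sub>1]\<close>.\<close>

definition br :: "('b list \<Rightarrow> 'a::field_char_0) \<Rightarrow> 'b \<Rightarrow> 'b list \<Rightarrow> 'a" where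
  "br h x t = h (t @ [x]) - h (x # t)"

text \<open>Left-normed brackets of letters span the free Lie algebra, so testing them alone amounts
  to vanishing on all Lie polynomials.\<close>

definition lie_null :: "('b list \<Rightarrow> 'a::field_char_0) \<Rightarrow> bool" where
  "lie_null h \<longleftrightarrow> (\<forall>xs x. foldl br h xs [x] = 0)"

text \<open>Lie polynomials of degree \<open>r\<close> are mapped to \<open>(-1)\<^sup>r\<^sup>-\<^sup>1\<close> times themselves by reversal of
  words, so only the part of a functional with this symmetry matters.\<close>

definition twisted :: "('b list \<Rightarrow> 'a::field_char_0) \<Rightarrow> bool" where
  "twisted h \<longleftrightarrow> (\<forall>t. h (rev t) = - ((- 1) ^ length t * h t))"

text \<open>The transpose of the c-fold bracket [...[t, x], ..., x]; \<open>strip_sum\<close> is its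
  binomial expansion.\<close>

definition strip :: "nat \<Rightarrow> 'b \<Rightarrow> ('b list \<Rightarrow> 'a::field_char_0) \<Rightarrow> 'b list \<Rightarrow> 'a" where
  "strip c x = (\<lambda>g. br g x) ^^ c"

lemma lie_null_br: "lie_null h \<Longrightarrow> lie_null (br h x)"
  unfolding lie_null_def by (metis foldl_Cons)

lemma lie_null_single: "lie_null h \<Longrightarrow> h [x] = 0"
  unfolding lie_null_def by (metis foldl_Nil)

lemma lie_null_strip: "lie_null h \<Longrightarrow> lie_null (strip c x h)"
  by (induction c) (simp_all add: strip_def lie_null_br)

lemma twisted_br:
  assumes "twisted h"
  shows "twisted (br h x)"
  unfolding twisted_def
proof
  fix t
  have "h (rev (x # t)) = - ((- 1) ^ length (x # t) * h (x # t))"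
    "h (rev (t @ [x])) = - ((- 1) ^ length (t @ [x]) * h (t @ [x]))"
    using assms unfolding twisted_def by blast+
  then show "br h x (rev t) = - ((- 1) ^ length t * br h x t)"
    by (simp add: br_def algebra_simps)
qed

lemma twisted_strip: "twisted h \<Longrightarrow> twisted (strip c x h)"
  by (induction c) (simp_all add: strip_def twisted_br)

lemma foldl_br_scale: "foldl br (\<lambda>t. c * h t) xs = (\<lambda>t. c * foldl br h xs t)"
proof (induction xs arbitrary: h)
  case (Cons x xs)
  have "br (\<lambda>t. c * h t) x = (\<lambda>t. c * br h x t)"
    by (rule ext) (simp add: br_def algebra_simps)
  then show ?case by (simp add: Cons.IH)
qed simp

lemma lie_null_scale:
  assumes "lie_null (\<lambda>t. c * h t)" "c \<noteq> 0"
  shows "lie_null h"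
  using assms unfolding lie_null_def foldl_br_scale by simp

lemma strip_sum:
  "strip c x h t = (\<Sum>i\<le>c. (- 1) ^ i * of_nat (c choose i)
     * h (replicate i x @ t @ replicate (c - i) x))"
proof (induction c arbitrary: t)
  case 0
  then show ?case by (simp add: strip_def)
next
  case (Suc c)
  define a where "a i = h (replicate i x @ t @ replicate (Suc c - i) x)" for i
  have 1: "strip c x h (t @ [x]) = (\<Sum>i\<le>c. (- 1) ^ i * of_nat (c choose i) * a i)"
    unfolding Suc.IH a_def
    by (rule sum.cong) (auto simp: Suc_diff_le)
  have 2: "strip c x h (x # t) = (\<Sum>i\<le>c. (- 1) ^ i * of_nat (c choose i) * a (Suc i))"
    unfolding Suc.IH a_def
    by (rule sum.cong) (auto simp flip: replicate_append_same)
  have 3: "(\<Sum>i\<le>c. (- 1) ^ i * of_nat (c choose i) * a i)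
      = a 0 + (\<Sum>i\<le>c. - ((- 1) ^ i * of_nat (c choose Suc i) * a (Suc i)))"
  proof -
    have "(\<Sum>i\<le>c. (- 1) ^ i * of_nat (c choose i) * a i)
      = (\<Sum>i\<le>Suc c. (- 1) ^ i * of_nat (c choose i) * a i)" by simp
    then show ?thesis by (simp only: sum.atMost_Suc_shift) simp
  qed
  have "(\<Sum>i\<le>Suc c. (- 1) ^ i * of_nat (Suc c choose i) * a i)
      = a 0 + (\<Sum>i\<le>c. - ((- 1) ^ i * of_nat (c choose Suc i) * a (Suc i)))
        - (\<Sum>i\<le>c. (- 1) ^ i * of_nat (c choose i) * a (Suc i))"
  proof -
    have "(\<Sum>i\<le>c. (- 1) ^ Suc i * of_nat (Suc c choose Suc i) * a (Suc i))
      = (\<Sum>i\<le>c. - ((- 1) ^ i * of_nat (c choose Suc i) * a (Suc i))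
          - (- 1) ^ i * of_nat (c choose i) * a (Suc i))"
      by (rule sum.cong) (simp_all add: algebra_simps)
    then show ?thesis by (simp only: sum.atMost_Suc_shift sum_subtractf) simp
  qed
  moreover have "strip (Suc c) x h t = strip c x h (t @ [x]) - strip c x h (x # t)"
    by (simp add: strip_def br_def)
  ultimately show ?case unfolding 1 2 3 by (simp add: a_def)
qed

lemma strip_one:
  assumes "\<And>i. i \<le> c \<Longrightarrow> h (replicate i x @ t @ replicate (c - i) x) \<noteq> 0 \<Longrightarrow> i = a"
    and "a \<le> c"
  shows "strip c x h t = (- 1) ^ a * of_nat (c choose a)
     * h (replicate a x @ t @ replicate (c - a) x)"
proof -
  have "strip c x h t = (\<Sum>i\<in>{a}. (- 1) ^ i * of_nat (c choose i)
     * h (replicate i x @ t @ replicate (c - i) x))"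
    unfolding strip_sum
  proof (rule sum.mono_neutral_right)
    show "\<forall>i\<in>{..c} - {a}. (- 1) ^ i * of_nat (c choose i)
        * h (replicate i x @ t @ replicate (c - i) x) = 0"
      using assms(1) by (metis DiffE atMost_iff mult_zero_right singletonI)
  qed (use assms(2) in auto)
  then show ?thesis by simp
qed

lemma strip_two:
  assumes "\<And>i. i \<le> c \<Longrightarrow> h (replicate i x @ t @ replicate (c - i) x) \<noteq> 0 \<Longrightarrow> i = a \<or> i = b"
    and "a \<le> c" "b \<le> c" "a \<noteq> b"
  shows "strip c x h t = (- 1) ^ a * of_nat (c choose a)
       * h (replicate a x @ t @ replicate (c - a) x)
     + (- 1) ^ b * of_nat (c choose b) * h (replicate b x @ t @ replicate (c - b) x)"
proof -
  have "strip c x h t = (\<Sum>i\<in>{a, b}. (- 1) ^ i * of_nat (c choose i)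
     * h (replicate i x @ t @ replicate (c - i) x))"
    unfolding strip_sum
  proof (rule sum.mono_neutral_right)
    show "\<forall>i\<in>{..c} - {a, b}. (- 1) ^ i * of_nat (c choose i)
        * h (replicate i x @ t @ replicate (c - i) x) = 0"
      using assms(1) by (metis DiffE atMost_iff insertCI mult_zero_right)
  qed (use assms(2,3) in auto)
  then show ?thesis using assms(4) by simp
qed

lemma strip_nonzero:
  assumes "strip c x h t \<noteq> 0"
  obtains i where "i \<le> c" "h (replicate i x @ t @ replicate (c - i) x) \<noteq> 0"
proof -
  have "\<exists>i\<in>{..c}. (- 1) ^ i * of_nat (c choose i)
     * h (replicate i x @ t @ replicate (c - i) x) \<noteq> 0"
    using assms unfolding strip_sum by (meson sum.neutral)
  then show ?thesis using that by auto
qed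

text \<open>If \<open>v\<close> is a palindrome, its length is odd, and \<open>y # v\<close> and
  \<open>v @ [y]\<close> are mirror images of even length. Twisting then gives them opposite values,
  which add up in \<open>br\<close>. Otherwise the second value is 0.\<close>

lemma br_nonzero:
  assumes "twisted g" "\<not> (even (length v) \<and> rev v = v)"
    and "g (y # v) \<noteq> 0" "g (v @ [y]) \<noteq> 0 \<Longrightarrow> rev v = v"
  shows "br g y v \<noteq> 0"
proof (cases "rev v = v")
  case True
  have "g (rev (y # v)) = - ((- 1) ^ length (y # v) * g (y # v))"
    using assms(1) unfolding twisted_def by blast
  then show ?thesis using True assms(2,3) by (simp add: br_def)
next
  case False
  then show ?thesis using assms by (auto simp: br_def)
qed

section \<open>Splitting off outer runs of one letter\<close>

lemma replicate_lead_eq: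
  assumes "replicate i x @ t = replicate p x @ u" "u \<noteq> []" "hd u \<noteq> x"
  shows "i \<le> p \<and> t = replicate (p - i) x @ u"
proof -
  have "i \<le> p"
  proof (rule ccontr)
    assume "\<not> i \<le> p"
    then have "replicate i x = replicate p x @ x # replicate (i - p - 1) x"
      by (metis Suc_diff_1 Suc_diff_eq_diff_pred diff_is_0_eq le_add_diff_inverse nat_le_linear
          neq0_conv replicate_Suc replicate_add)
    with assms show False by auto
  qed
  then have "replicate p x = replicate i x @ replicate (p - i) x"
    by (simp flip: replicate_add)
  with assms \<open>i \<le> p\<close> show ?thesis by simp
qed

text \<open>As \<open>u\<close> neither starts nor ends with \<open>x\<close>, the outer runs on the
  right-hand side have lengths exactly \<open>p\<close> and \<open>q\<close>, and no splitting can
  take more. This decides which summands of \<open>strip_sum\<close> meet the support of a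
  functional.\<close>

lemma replicate_both_eq:
  assumes "replicate i x @ t @ replicate j x = replicate p x @ u @ replicate q x"
    and "u \<noteq> []" "hd u \<noteq> x" "last u \<noteq> x"
  shows "i \<le> p \<and> j \<le> q \<and> t = replicate (p - i) x @ u @ replicate (q - j) x"
proof -
  have 1: "i \<le> p" "t @ replicate j x = replicate (p - i) x @ u @ replicate q x"
    using replicate_lead_eq[OF assms(1)] assms by auto
  have "rev (t @ replicate j x) = rev (replicate (p - i) x @ u @ replicate q x)"
    using 1(2) by simp
  then have "replicate j x @ rev t = replicate q x @ (rev u @ replicate (p - i) x)" by simp
  from replicate_lead_eq[OF this] have "j \<le> q"
      "rev t = replicate (q - j) x @ rev u @ replicate (p - i) x"
    using assms by (auto simp: hd_append hd_rev)
  then have "rev (rev t) = rev (replicate (q - j) x @ rev u @ replicate (p - i) x)" by simp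
  with 1 \<open>j \<le> q\<close> show ?thesis by simp
qed

lemma outer_runs:
  assumes "z \<in> set w" "z \<noteq> x"
  obtains p u q where "w = replicate p x @ u @ replicate q x" "u \<noteq> []" "hd u \<noteq> x" "last u \<noteq> x"
proof -
  define v where "v = dropWhile (\<lambda>y. y = x) w"
  have z: "z \<in> set v" using assms unfolding v_def
    by (metis (full_types) Un_iff set_append set_takeWhileD takeWhile_dropWhile_id)
  obtain p where w: "w = replicate p x @ v"
    unfolding v_def
    by (metis (full_types) replicate_length_same set_takeWhileD takeWhile_dropWhile_id)
  have hv: "v \<noteq> []" using z by auto
  then have hd_v: "hd v \<noteq> x" unfolding v_def by (rule hd_dropWhile)
  define u where "u = rev (dropWhile (\<lambda>y. y = x) (rev v))"
  have zu: "z \<in> set u" using z assms unfolding u_def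
    by (metis (full_types) Un_iff set_append set_rev set_takeWhileD takeWhile_dropWhile_id)
  have "rev v = replicate (length (takeWhile (\<lambda>y. y = x) (rev v))) x @ rev u"
    unfolding u_def
    by (metis (full_types) replicate_length_same rev_rev_ident set_takeWhileD
        takeWhile_dropWhile_id)
  then obtain q where v: "v = u @ replicate q x"
    by (metis rev_append rev_replicate rev_rev_ident)
  have u: "u \<noteq> []" using zu by auto
  then have "last u \<noteq> x"
    unfolding u_def using hd_dropWhile[of "\<lambda>y. y = x" "rev v"] by (simp add: last_rev)
  moreover have "hd u \<noteq> x" using hd_v v u by (metis hd_append2)
  ultimately show ?thesis using that[OF _ u, of p q] w v by simp
qed

text \<open>A single letter is itself a Lie polynomial, so it is excluded from the powers; the empty
  word counts as exempt.\<close>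

definition exempt :: "'b list \<Rightarrow> bool" where
  "exempt w \<longleftrightarrow> (\<exists>x. w = replicate (length w) x \<and> length w \<noteq> 1) \<or> (even (length w) \<and> rev w = w)"

lemma exempt_rev: "exempt (rev w) \<longleftrightarrow> exempt w"
proof -
  have "rev w = replicate n x \<longleftrightarrow> w = replicate n x" for n and x :: 'a
    by (metis rev_replicate rev_rev_ident)
  then show ?thesis unfolding exempt_def by auto
qed

lemma exempt_palindrome:
  assumes "exempt w"
  shows "rev w = w"
proof (cases "even (length w) \<and> rev w = w")
  case False
  then obtain x where "w = replicate (length w) x" using assms unfolding exempt_def by blast
  then show ?thesis by (metis rev_replicate)
qed simp

lemma not_exempt_hd_last: "hd w \<noteq> last w \<Longrightarrow> \<not> exempt w"
  using exempt_palindrome[of w] by (metis hd_rev)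

text \<open>The two halves are mirror images. This parity is the recurring way to see that a word is
  not exempt.\<close>

lemma even_palindrome_count:
  assumes "even (length w)" "rev w = w"
  shows "even (count_list w x)"
proof -
  define n where "n = length w div 2"
  have n: "length w = n + n" using assms(1) unfolding n_def by presburger
  have "drop n w = rev (take n w)"
    using assms(2) n by (metis diff_add_inverse2 rev_take)
  then have "w = take n w @ rev (take n w)" by (metis append_take_drop_id)
  then have "count_list w x = count_list (take n w) x + count_list (take n w) x"
    by (metis count_list_append count_list_rev)
  then show ?thesis by simp
qed


text \<open>If \<open>p = q\<close> or \<open>u\<close> is no palindrome, one summand of
  \<open>strip_sum\<close> contributes at \<open>u\<close>. Otherwise the word and its reverse both
  contribute; \<open>u\<close> then has odd length, and twisting makes the two contributions equal.
  For an even palindrome \<open>u\<close> they would be opposite.\<close>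

lemma strip_concentrated:
  fixes h :: "'b list \<Rightarrow> 'a::field_char_0"
  assumes "twisted h" "\<not> (even (length u) \<and> rev u = u)"
    and "h (replicate p x @ u @ replicate q x) \<noteq> 0"
    and key: "\<And>i t. i \<le> p + q \<Longrightarrow> h (replicate i x @ t @ replicate (p + q - i) x) \<noteq> 0
      \<Longrightarrow> (i = p \<and> t = u) \<or> (i = q \<and> t = rev u)"
  shows "strip (p + q) x h t \<noteq> 0 \<Longrightarrow> t = u \<or> t = rev u"
    and "strip (p + q) x h u \<noteq> 0"
proof -
  show "t = u \<or> t = rev u" if "strip (p + q) x h t \<noteq> 0"
    using strip_nonzero[OF that] key by metis
  define w where "w = replicate p x @ u @ replicate q x"
  have hrev: "h (rev w) = - ((- 1) ^ (p + q + length u) * h w)"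
  proof -
    have "h (rev w) = - ((- 1) ^ length w * h w)" using assms(1) unfolding twisted_def by blast
    moreover have "length w = p + q + length u" by (simp add: w_def)
    ultimately show ?thesis by simp
  qed
  show "strip (p + q) x h u \<noteq> 0"
  proof (cases "p = q \<or> rev u \<noteq> u")
    case True
    have "strip (p + q) x h u = (- 1) ^ p * of_nat ((p + q) choose p)
        * h (replicate p x @ u @ replicate (p + q - p) x)"
      by (rule strip_one) (use key True in metis, simp)
    then show ?thesis using assms(3) by simp
  next
    case False
    have "strip (p + q) x h u = (- 1) ^ p * of_nat ((p + q) choose p)
        * h (replicate p x @ u @ replicate (p + q - p) x) + (- 1) ^ q
        * of_nat ((p + q) choose q) * h (replicate q x @ u @ replicate (p + q - q) x)"
      by (rule strip_two) (use key False in \<open>metis, simp, simp, simp\<close>)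
    moreover have "replicate q x @ u @ replicate (p + q - q) x = rev w"
      "replicate p x @ u @ replicate (p + q - p) x = w"
      using False by (simp_all add: w_def)
    moreover have "(p + q) choose q = (p + q) choose p"
      by (metis add_diff_cancel_right' binomial_symmetric le_add2)
    moreover have "odd (length u)" using False assms(2) by blast
    then have "(- 1) ^ q * h (rev w) = (- 1) ^ p * h w"
      unfolding hrev by (auto simp: minus_one_power_iff)
    ultimately have "strip (p + q) x h u = 2 * ((- 1) ^ p * of_nat ((p + q) choose p) * h w)"
      by (simp only: ac_simps) (simp add: algebra_simps)
    then show ?thesis using assms(3) by (simp add: w_def)
  qed
qed

text \<open>Only taking all \<open>c\<close> letters from the left can expose \<open>y\<close>
  there. Twisting mirrors this at the right end, and \<open>br_nonzero\<close> combines both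
  ends.\<close>

lemma strip_br_concentrated:
  fixes h :: "'b list \<Rightarrow> 'a::field_char_0"
  assumes "twisted h" "\<not> (even (length v) \<and> rev v = v)"
    and "h (replicate c x @ y # v) \<noteq> 0"
    and key: "\<And>i t. i \<le> c \<Longrightarrow> h (replicate i x @ (y # t) @ replicate (c - i) x) \<noteq> 0
      \<Longrightarrow> i = c \<and> t = v"
  shows "br (strip c x h) y t \<noteq> 0 \<Longrightarrow> t = v \<or> t = rev v"
    and "br (strip c x h) y v \<noteq> 0"
proof -
  define g where "g = strip c x h"
  have tw: "twisted g" unfolding g_def using assms(1) by (rule twisted_strip)
  have left: "t = v" if "g (y # t) \<noteq> 0" for t
    using strip_nonzero[OF that[unfolded g_def]] key by metis
  have right: "rev t = v" if "g (t @ [y]) \<noteq> 0" for t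
  proof (rule left)
    have "g (rev (t @ [y])) = - ((- 1) ^ length (t @ [y]) * g (t @ [y]))"
      using tw unfolding twisted_def by blast
    with that show "g (y # rev t) \<noteq> 0" by simp
  qed
  show "t = v \<or> t = rev v" if "br (strip c x h) y t \<noteq> 0"
  proof (cases "g (t @ [y]) = 0")
    case True
    then have "g (y # t) \<noteq> 0" using that by (simp add: br_def g_def)
    then show ?thesis using left by blast
  next
    case False
    then have "rev t = v" by (rule right)
    then show ?thesis by auto
  qed
  have "g (y # v) = (- 1) ^ c * of_nat (c choose c)
      * h (replicate c x @ (y # v) @ replicate (c - c) x)"
    unfolding g_def by (rule strip_one) (use key in blast, simp)
  then have "g (y # v) \<noteq> 0" using assms(3) by simp
  then have "br g y v \<noteq> 0"
    using right by (intro br_nonzero[OF tw assms(2)])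
  then show "br (strip c x h) y v \<noteq> 0" unfolding g_def .
qed

text \<open>The theorem of Duchamp and Thibon on the support of the free Lie algebra.\<close>

lemma exempt_if_lie_null:
  fixes h :: "bool list \<Rightarrow> 'a::field_char_0"
  assumes "lie_null h" "twisted h" "\<And>t. h t \<noteq> 0 \<Longrightarrow> t = w \<or> t = rev w" "h w \<noteq> 0"
  shows "exempt w"
  using assms
proof (induction "length w" arbitrary: w h rule: less_induct)
  case less
  note null = less.prems(1) and tw = less.prems(2) and supp = less.prems(3)
  show ?case
  proof (rule ccontr)
    assume ne: "\<not> exempt w"
    define x where "x = hd w"
    have len: "length w \<noteq> 0"
      using ne unfolding exempt_def by auto
    have len1: "length w \<noteq> 1"
      using lie_null_single[OF null] less.prems(4) by (metis One_nat_def length_0_conv length_Suc_conv)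
    obtain z where z: "z \<in> set w" "z \<noteq> x"
    proof -
      have "w \<noteq> replicate (length w) x" using ne len1 unfolding exempt_def by blast
      then show ?thesis using that replicate_length_same[of w x] by metis
    qed
    obtain p u q where w: "w = replicate p x @ u @ replicate q x"
      and u: "u \<noteq> []" "hd u \<noteq> x" "last u \<noteq> x"
      using outer_runs[OF z] .
    have "p \<noteq> 0" using w u x_def by (cases p) auto
    \<comment> \<open>By twisting, the reverse word is also in the support, so the shorter outer run
      may be assumed to stand on the left.\<close>
    have "\<exists>w' p u q. \<not> exempt w' \<and> h w' \<noteq> 0 \<and> (\<forall>t. h t \<noteq> 0 \<longrightarrow> t = w' \<or> t = rev w')
        \<and> w' = replicate p x @ u @ replicate q x \<and> u \<noteq> [] \<and> hd u \<noteq> x \<and> last u \<noteq> x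
        \<and> p \<le> q \<and> q \<noteq> 0 \<and> length w' = length w"
    proof (cases "p \<le> q")
      case True
      then show ?thesis
        using ne less.prems(3,4) w u \<open>p \<noteq> 0\<close>
        by (intro exI[of _ w] exI[of _ p] exI[of _ u] exI[of _ q]) auto
    next
      case False
      have "h (rev w) \<noteq> 0" using tw less.prems(4) unfolding twisted_def by simp
      moreover have "rev w = replicate q x @ rev u @ replicate p x" by (simp add: w)
      moreover have "\<forall>t. h t \<noteq> 0 \<longrightarrow> t = rev w \<or> t = rev (rev w)" using supp by auto
      moreover have "rev u \<noteq> []" "hd (rev u) \<noteq> x" "last (rev u) \<noteq> x"
        using u by (simp_all add: hd_rev last_rev)
      moreover have "\<not> exempt (rev w)" "length (rev w) = length w" "q \<le> p"
        using ne False by (simp_all add: exempt_rev)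
      ultimately show ?thesis using \<open>p \<noteq> 0\<close> by blast
    qed
    then obtain w0 p u q where ne0: "\<not> exempt w0" and hw0: "h w0 \<noteq> 0"
      and supp0: "\<And>t. h t \<noteq> 0 \<Longrightarrow> t = w0 \<or> t = rev w0"
      and w0: "w0 = replicate p x @ u @ replicate q x"
      and u: "u \<noteq> []" "hd u \<noteq> x" "last u \<noteq> x" and pq: "p \<le> q" "q \<noteq> 0"
      and len0: "length w0 = length w" by blast
    have rev_w0: "rev w0 = replicate q x @ rev u @ replicate p x" by (simp add: w0)
    have ru: "rev u \<noteq> []" "hd (rev u) \<noteq> x" "last (rev u) \<noteq> x"
      using u by (simp_all add: hd_rev last_rev)
    show False
    proof (cases "exempt u")
      case False
      have key: "(i = p \<and> t = u) \<or> (i = q \<and> t = rev u)"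
        if "i \<le> p + q" "h (replicate i x @ t @ replicate (p + q - i) x) \<noteq> 0" for i t
        using supp0[OF that(2)]
      proof
        assume "replicate i x @ t @ replicate (p + q - i) x = w0"
        from replicate_both_eq[OF this[unfolded w0] u] that(1) show ?thesis by auto
      next
        assume "replicate i x @ t @ replicate (p + q - i) x = rev w0"
        from replicate_both_eq[OF this[unfolded rev_w0] ru] that(1) show ?thesis by auto
      qed
      have "exempt u"
      proof (rule less.hyps)
        show "length u < length w" using pq len0 by (simp add: w0)
        show "lie_null (strip (p + q) x h)" "twisted (strip (p + q) x h)"
          using null tw by (simp_all add: lie_null_strip twisted_strip)
        have *: "\<not> (even (length u) \<and> rev u = u)" using False unfolding exempt_def by blast
        have "h (replicate p x @ u @ replicate q x) \<noteq> 0" using hw0 by (simp add: w0)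
        note conc = strip_concentrated[OF tw * this key]
        show "t = u \<or> t = rev u" if "strip (p + q) x h t \<noteq> 0" for t
          using conc(1) that by blast
        show "strip (p + q) x h u \<noteq> 0"
          using conc(2) by blast
      qed
      with False show False ..
    next
      case True
      \<comment> \<open>An exempt core gives no contradiction by induction. So only as many
        \<open>x\<close> as the shorter run has are stripped, and then one \<open>y\<close>, the
        first letter of the core. The longer run stays in \<open>v\<close> and spoils its
        symmetry.\<close>
      define y where "y = (\<not> x)"
      have y: "b \<noteq> x \<longleftrightarrow> b = y" for b unfolding y_def by auto
      obtain u' where uy: "u = y # u'" using u(1,2) y by (cases u) auto
      have "length u \<noteq> 1" using True unfolding exempt_def by auto
      then have u': "u' \<noteq> []" "last u' = y" using u uy y by auto
      have ru: "rev u = u" using exempt_palindrome[OF True] .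
      define v where "v = u' @ replicate q x"
      have key: "i = p \<and> t = v"
        if "i \<le> p" "h (replicate i x @ (y # t) @ replicate (p - i) x) \<noteq> 0" for i t
      proof -
        have *: "i = r \<and> t = u' @ replicate (s - (p - i)) x"
          if "replicate i x @ (y # t) @ replicate (p - i) x = replicate r x @ u @ replicate s x"
          for r s
        proof -
          from replicate_both_eq[OF that u] have "i \<le> r"
            "y # t = replicate (r - i) x @ u @ replicate (s - (p - i)) x" by auto
          then show ?thesis using y uy by (cases "r - i") auto
        qed
        from supp0[OF that(2)] show ?thesis
        proof
          assume "replicate i x @ (y # t) @ replicate (p - i) x = w0"
          from *[OF this[unfolded w0]] show ?thesis by (simp add: v_def)
        next
          assume "replicate i x @ (y # t) @ replicate (p - i) x = rev w0"
          from *[OF this[unfolded rev_w0 ru]] that(1) pq show ?thesis by (simp add: v_def)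
        qed
      qed
      have "\<not> exempt v"
      proof
        assume ev: "exempt v"
        have "y \<in> set u'" using last_in_set[OF u'(1)] unfolding u'(2) .
        then have "x \<in> set v" "y \<in> set v" using pq(2) by (simp_all add: v_def)
        then have "v \<noteq> replicate n z" for n z using y by (metis in_set_replicate)
        then have pal: "even (length v)" "rev v = v" using ev unfolding exempt_def by blast+
        then have c: "even (count_list v y)" by (rule even_palindrome_count)
        \<comment> \<open>If \<open>u\<close> is an even palindrome, dropping one \<open>y\<close>
          leaves an odd number of them. Otherwise \<open>u\<close> is a power of \<open>y\<close>,
          and \<open>v\<close> starts with \<open>y\<close> but ends with \<open>x\<close>.\<close>
        show False
        proof (cases "even (length u)")
          case True
          have "y \<notin> set (replicate q x)" using y[of y] by simp
          then have "count_list v y = count_list u' y"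
            by (simp add: v_def count_list_append count_list_0_iff)
          with even_palindrome_count[OF True ru, of y] c show False by (simp add: uy)
        next
          case False
          then obtain z where "u = replicate (length u) z" using True unfolding exempt_def by blast
          then have "hd u' = y" using u' uy
            by (metis hd_in_set in_set_replicate list.set_intros(1) list.set_intros(2))
          then have "hd v = y" using u' by (simp add: v_def)
          moreover have "last v = x" using pq(2) by (simp add: v_def)
          ultimately show False using pal(2) y by (metis hd_rev)
        qed
      qed
      moreover have "exempt v"
      proof (rule less.hyps)
        show "length v < length w" using len0 by (simp add: w0 uy v_def)
        show "lie_null (br (strip p x h) y)" "twisted (br (strip p x h) y)"
          using null tw by (simp_all add: lie_null_strip lie_null_br twisted_strip twisted_br)
        have *: "\<not> (even (length v) \<and> rev v = v)"
          using \<open>\<not> exempt v\<close> unfolding exempt_def by blast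
        have "h (replicate p x @ y # v) \<noteq> 0" using hw0 by (simp add: w0 uy v_def)
        note conc = strip_br_concentrated[OF tw * this key]
        show "t = v \<or> t = rev v" if "br (strip p x h) y t \<noteq> 0" for t
          using conc(1) that by blast
        show "br (strip p x h) y v \<noteq> 0"
          using conc(2) by blast
      qed
      ultimately show False by blast
    qed
  qed
qed

section \<open>Deformations of a palindrome\<close>

text \<open>\<open>enc [m\<^sub>0, \<dots>, m\<^sub>r] = D\<^sup>m\<^sup>0 E D\<^sup>m\<^sup>1 E \<dots> E D\<^sup>m\<^sup>r\<close>, where \<open>E\<close> is the letter \<open>True\<close> and \<open>D\<close> the
  letter \<open>False\<close>.\<close>

fun enc :: "nat list \<Rightarrow> bool list" where
  "enc [] = []"
| "enc [a] = replicate a False"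
| "enc (a # b # m) = replicate a False @ True # enc (b # m)"

lemma enc_Cons: "m \<noteq> [] \<Longrightarrow> enc (a # m) = replicate a False @ True # enc m"
  by (cases m) auto

lemma enc_append: "u \<noteq> [] \<Longrightarrow> v \<noteq> [] \<Longrightarrow> enc (u @ v) = enc u @ True # enc v"
proof (induction u)
  case (Cons a u)
  then show ?case by (cases "u = []") (simp_all add: enc_Cons)
qed simp

lemma enc_rev: "enc (rev m) = rev (enc m)"
proof (induction m)
  case (Cons a m)
  then show ?case by (cases "m = []") (simp_all add: enc_Cons enc_append)
qed simp

lemma enc_add_hd: "replicate i False @ enc (a # m) = enc ((i + a) # m)"
  by (cases m) (simp_all add: replicate_add)

lemma enc_add_last: "enc (m @ [a]) @ replicate i False = enc (m @ [a + i])"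
  by (cases "m = []") (simp_all add: enc_append replicate_add)

lemma enc_zeros_hd: "m \<noteq> [] \<Longrightarrow> enc (replicate i 0 @ m) = replicate i True @ enc m"
  by (induction i) (simp_all add: enc_Cons)

lemma enc_zeros_last: "m \<noteq> [] \<Longrightarrow> enc (m @ replicate i 0) = enc m @ replicate i True"
  using enc_rev[of "replicate i 0 @ rev m"] by (simp add: enc_zeros_hd enc_rev)

lemma enc_surj: "\<exists>m. m \<noteq> [] \<and> enc m = w"
proof (induction w)
  case Nil
  then show ?case by (intro exI[of _ "[0]"]) simp
next
  case (Cons x w)
  then obtain m where m: "m \<noteq> []" "enc m = w" by blast
  then obtain a m' where m': "m = a # m'" by (cases m) auto
  show ?case
  proof (cases x)
    case True
    then show ?thesis using m by (intro exI[of _ "0 # m"]) (simp add: enc_Cons)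
  next
    case False
    then show ?thesis using m m' enc_add_hd[of 1 a m']
      by (intro exI[of _ "Suc a # m'"]) simp
  qed
qed

text \<open>A left inverse of \<open>enc\<close> on nonempty lists only: \<open>enc []\<close> and
  \<open>enc [0]\<close> are both the empty word.\<close>

fun dec :: "bool list \<Rightarrow> nat list" where
  "dec [] = [0]"
| "dec (True # w) = 0 # dec w"
| "dec (False # w) = Suc (hd (dec w)) # tl (dec w)"

lemma dec_replicate: "dec (replicate a False @ w) = (a + hd (dec w)) # tl (dec w)"
proof (induction a)
  case 0
  have "dec w \<noteq> []" by (induction w rule: dec.induct) auto
  then show ?case by simp
qed simp

lemma dec_enc: "m \<noteq> [] \<Longrightarrow> dec (enc m) = m"
proof (induction m)
  case (Cons a m)
  show ?case
  proof (cases "m = []")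
    case True
    then show ?thesis using dec_replicate[of a "[]"] by simp
  next
    case False
    then show ?thesis using Cons by (simp add: enc_Cons dec_replicate)
  qed
qed simp

lemma enc_inj: "m \<noteq> [] \<Longrightarrow> m' \<noteq> [] \<Longrightarrow> enc m = enc m' \<Longrightarrow> m = m'"
  by (metis dec_enc)

lemma Suc_count_enc: "m \<noteq> [] \<Longrightarrow> Suc (count_list (enc m) True) = length m"
proof (induction m)
  case (Cons a m)
  have "count_list (replicate a False) True = 0" by (simp add: count_list_0_iff)
  with Cons show ?case
    by (cases "m = []") (simp_all add: enc_Cons count_list_append)
qed simp

lemma hd_enc: "hd m \<noteq> 0 \<Longrightarrow> m \<noteq> [] \<Longrightarrow> enc m \<noteq> [] \<and> hd (enc m) = False"
proof (cases m)
  case (Cons a m')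
  moreover assume "hd m \<noteq> 0"
  ultimately show ?thesis by (cases m'; cases a) auto
qed simp

lemma last_enc: "last m \<noteq> 0 \<Longrightarrow> m \<noteq> [] \<Longrightarrow> last (enc m) = False"
  using hd_enc[of "rev m"] by (simp add: hd_rev enc_rev)

text \<open>With outer entries 0, \<open>enc\<close> yields the part from the first E to the last
  one. This puts words into the form required by \<open>replicate_both_eq\<close>.\<close>

lemma enc_core: "enc (f # x @ [l]) = replicate f False @ enc (0 # x @ [0]) @ replicate l False"
  using enc_add_hd[of f 0 "x @ [0]"] enc_add_last[of "f # x" 0 l]
  by (metis add_0 add_0_right append_Cons append_assoc)

lemma enc_core_ends:
  "enc (0 # x @ [0]) \<noteq> []" "hd (enc (0 # x @ [0])) \<noteq> False" "last (enc (0 # x @ [0])) \<noteq> False"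
proof -
  show "enc (0 # x @ [0]) \<noteq> []" "hd (enc (0 # x @ [0])) \<noteq> False"
    using enc_Cons[of "x @ [0]" 0] by simp_all
  show "last (enc (0 # x @ [0])) \<noteq> False"
    using enc_append[of "0 # x" "[0]"] by simp
qed

text \<open>Under \<open>enc\<close>, these are the results of replacing one factor \<open>D\<^sup>p E D\<^sup>q\<close> by \<open>E\<close>.\<close>

definition fam :: "nat \<Rightarrow> nat list \<Rightarrow> nat list set" where
  "fam \<delta> m = {u @ [a, b] @ v | u a b v. \<exists>p q. m = u @ [a + p, b + q] @ v \<and> p + q = \<delta>}"

lemma famI: "m = u @ [a + p, b + q] @ v \<Longrightarrow> p + q = \<delta> \<Longrightarrow> u @ [a, b] @ v \<in> fam \<delta> m"
  unfolding fam_def by blast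

lemma famE:
  assumes "x \<in> fam \<delta> m"
  obtains u a b v p q where "x = u @ [a, b] @ v" "m = u @ [a + p, b + q] @ v" "p + q = \<delta>"
  using assms unfolding fam_def by blast

lemma fam_le: "x \<in> fam \<delta> m \<Longrightarrow> list_all2 (\<le>) x m"
  by (elim famE) (auto intro!: list_all2_appendI simp: list_all2_same)

lemma fam_sum: "x \<in> fam \<delta> m \<Longrightarrow> sum_list x + \<delta> = sum_list m"
  by (elim famE) auto

lemma fam_rev: "x \<in> fam \<delta> m \<Longrightarrow> rev x \<in> fam \<delta> (rev m)"
  by (elim famE) (use famI[of _ "rev _" _ _ _ _ "rev _"] in \<open>force simp: add.commute\<close>)

text \<open>An entry 0 cannot be lowered. If the deformed pair contains the leading 0, its other
  entry takes all of \<delta>, and the pair can be shifted one place to the right.\<close>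

lemma fam_Cons_0:
  assumes "x \<in> fam \<delta> (0 # m)" "length m \<ge> 2"
  shows "\<exists>x'\<in>fam \<delta> m. x = 0 # x'"
proof -
  from assms(1) obtain u a b v p q where x: "x = u @ [a, b] @ v"
    and m: "0 # m = u @ [a + p, b + q] @ v" and pq: "p + q = \<delta>" by (rule famE)
  show ?thesis
  proof (cases u)
    case Nil
    then obtain z v' where v: "v = z # v'" using assms(2) m by (cases v) auto
    have "[] @ [b, z] @ v' \<in> fam \<delta> m"
      by (rule famI[where p = q and q = 0]) (use m pq Nil v in auto)
    then show ?thesis using x m Nil v by auto
  next
    case (Cons c u')
    have "u' @ [a, b] @ v \<in> fam \<delta> m"
      by (rule famI) (use m pq Cons in auto)
    then show ?thesis using x m Cons by auto
  qed
qed

lemma fam_zeros: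
  assumes "x \<in> fam \<delta> (replicate e 0 @ m @ replicate e' 0)" "length m \<ge> 2"
  shows "\<exists>x'\<in>fam \<delta> m. x = replicate e 0 @ x' @ replicate e' 0"
proof -
  have left: "\<exists>x'\<in>fam \<delta> m. x = replicate e 0 @ x'"
    if "x \<in> fam \<delta> (replicate e 0 @ m)" "length m \<ge> 2" for x m e
    using that(1)
  proof (induction e arbitrary: x)
    case (Suc e)
    then have "x \<in> fam \<delta> (0 # replicate e 0 @ m)" by simp
    from fam_Cons_0[OF this] Suc.IH that(2) show ?case by fastforce
  qed simp
  from left[OF assms(1)] assms(2) obtain y where y: "y \<in> fam \<delta> (m @ replicate e' 0)"
    "x = replicate e 0 @ y" by auto
  have "rev y \<in> fam \<delta> (replicate e' 0 @ rev m)" using fam_rev[OF y(1)] by simp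
  from left[OF this] assms(2) obtain z where z: "z \<in> fam \<delta> (rev m)" "rev y = replicate e' 0 @ z"
    by auto
  then have "rev z \<in> fam \<delta> m" "y = rev z @ replicate e' 0"
    using fam_rev[OF z(1)] by (auto simp: rev_swap)
  then show ?thesis using y by auto
qed

text \<open>Only two adjacent entries change, and \<open>mid\<close> separates the two ends, so at
  most one outer run gets shorter. The three cases are: none, the left one, the right one.\<close>

lemma fam_ends:
  assumes "x \<in> fam \<delta> (a # mid @ [a'])" "mid \<noteq> []"
  obtains y where "x = a # y @ [a']" "0 # y @ [0] \<in> fam \<delta> (0 # mid @ [0])"
  | f p q b v where "p \<noteq> 0" "f + p = a" "p + q = \<delta>" "mid = (b + q) # v" "x = f # b # v @ [a']"
  | l p q b v where "p \<noteq> 0" "l + p = a'" "p + q = \<delta>" "mid = v @ [b + q]" "x = a # v @ [b, l]"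
proof -
  from assms(1) obtain u c b v p q where x: "x = u @ [c, b] @ v"
    and m: "a # mid @ [a'] = u @ [c + p, b + q] @ v" and pq: "p + q = \<delta>" by (rule famE)
  show thesis
  proof (cases u)
    case Nil
    then have "c + p = a" "(b + q) # v = mid @ [a']" using m by auto
    then obtain v' where v: "v = v' @ [a']" "mid = (b + q) # v'"
      using assms(2) by (cases v rule: rev_cases) auto
    show thesis
    proof (cases "p = 0")
      case True
      have "[] @ [0, b] @ (v' @ [0]) \<in> fam \<delta> (0 # mid @ [0])"
        by (rule famI[where p = 0 and q = q]) (use v pq True in auto)
      then show ?thesis using that(1)[of "b # v'"] x Nil v \<open>c + p = a\<close> True by auto
    next
      case False
      then show ?thesis using that(2)[of p c q b v'] x Nil v \<open>c + p = a\<close> pq by auto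
    qed
  next
    case (Cons z u')
    then have z: "z = a" and m': "mid @ [a'] = u' @ [c + p, b + q] @ v" using m by auto
    show thesis
    proof (cases v rule: rev_cases)
      case Nil
      then have "(u' @ [c + p]) @ [b + q] = mid @ [a']" using m' by simp
      then have mid: "mid = u' @ [c + p]" "b + q = a'" by (simp_all only: append1_eq_conv)
      show thesis
      proof (cases "q = 0")
        case True
        have "(0 # u') @ [c, 0] @ [] \<in> fam \<delta> (0 # mid @ [0])"
          by (rule famI[where p = p and q = 0]) (use mid pq True in auto)
        then show ?thesis using that(1)[of "u' @ [c]"] x Nil Cons z mid True by auto
      next
        case False
        then show ?thesis using that(3)[of q b p u' c] x Nil Cons z mid pq by auto
      qed
    next
      case (snoc v' y)
      then have "(u' @ [c + p, b + q] @ v') @ [y] = mid @ [a']" using m' by simp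
      then have mid: "mid = u' @ [c + p, b + q] @ v'" "y = a'" by (simp_all only: append1_eq_conv)
      have "(0 # u') @ [c, b] @ (v' @ [0]) \<in> fam \<delta> (0 # mid @ [0])"
        by (rule famI[where p = p and q = q]) (use mid pq in auto)
      then show ?thesis using that(1)[of "u' @ [c, b] @ v'"] x Cons z snoc mid by auto
    qed
  qed
qed

lemma twisted_sandwich:
  fixes h :: "'b list \<Rightarrow> 'a::field_char_0"
  assumes "twisted h"
  shows "twisted (\<lambda>t. h (replicate a x @ t @ replicate a x))"
  unfolding twisted_def
proof
  fix t
  let ?w = "replicate a x @ t @ replicate a x"
  have "h (rev ?w) = - ((- 1) ^ length ?w * h ?w)" using assms unfolding twisted_def by blast
  moreover have "(- 1 :: 'a) ^ length ?w = (- 1) ^ length t"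
    by (auto simp: minus_one_power_iff)
  ultimately show "h (replicate a x @ rev t @ replicate a x) = - ((- 1) ^ length t * h ?w)"
    by simp
qed

text \<open>Only the middle summand of \<open>strip (2 * a) x h\<close> survives, so peeling equal
  runs off both ends is this functional up to the central binomial coefficient.\<close>

lemma lie_null_sandwich:
  assumes "lie_null h"
    and "\<And>i t. i \<le> 2 * a \<Longrightarrow> h (replicate i x @ t @ replicate (2 * a - i) x) \<noteq> 0 \<Longrightarrow> i = a"
  shows "lie_null (\<lambda>t. h (replicate a x @ t @ replicate a x))"
proof -
  have "strip (2 * a) x h
      = (\<lambda>t. (- 1) ^ a * of_nat (2 * a choose a) * h (replicate a x @ t @ replicate a x))"
  proof
    fix t
    have "strip (2 * a) x h t = (- 1) ^ a * of_nat ((2 * a) choose a)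
        * h (replicate a x @ t @ replicate (2 * a - a) x)"
      by (rule strip_one) (use assms(2) in blast, simp)
    then show "strip (2 * a) x h t
        = (- 1) ^ a * of_nat (2 * a choose a) * h (replicate a x @ t @ replicate a x)"
      by (simp add: mult_2)
  qed
  moreover have "lie_null (strip (2 * a) x h)" using assms(1) by (rule lie_null_strip)
  ultimately show ?thesis
    by (auto intro!: lie_null_scale[where c = "(- 1) ^ a * of_nat (2 * a choose a)"])
qed


text \<open>Up to sign the sum is \<open>(a + b) * x\<close> or \<open>(a - b) * x\<close>. It is
  used with two neighbouring binomial coefficients that differ.\<close>

lemma signed_sum_nonzero:
  fixes a b x y s s' :: "'a::field"
  assumes "s = 1 \<or> s = - 1" "s' = 1 \<or> s' = - 1" "y = x \<or> y = - x" "a \<noteq> b" "a + b \<noteq> 0" "x \<noteq> 0"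
  shows "s * a * x + s' * b * y \<noteq> 0"
proof -
  have "s * a * x + s' * b * y = s * ((a + b) * x) \<or> s * a * x + s' * b * y = s * ((a - b) * x)"
    using assms(1-3) by (auto simp: algebra_simps)
  moreover have "(a + b) * x \<noteq> 0" "(a - b) * x \<noteq> 0" "s \<noteq> 0" using assms by auto
  ultimately show ?thesis by (metis mult_eq_0_iff)
qed

text \<open>Using up the first run forces the deformed pair to be the first one, with
  \<open>p = hd m\<close>. Then \<open>q\<close> and the whole result are determined.\<close>

lemma fam_hd_zero:
  assumes "x \<in> fam \<delta> m" "length m \<ge> 3" "hd m \<noteq> 0" "hd x = 0"
  obtains b q v where "m = hd m # (b + q) # v" "hd m + q = \<delta>" "x = 0 # b # v" "v \<noteq> []"
proof -
  from assms(1) obtain u a b v p q where x: "x = u @ [a, b] @ v"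
    and m: "m = u @ [a + p, b + q] @ v" and pq: "p + q = \<delta>" by (rule famE)
  have "u = []" using assms(3,4) x m by (cases u) auto
  then show thesis using that[of b q v] x m pq assms(2-4) by (cases v) auto
qed

lemma list_all2_le_zeros: "list_all2 (\<le>) u (replicate e (0::nat)) \<Longrightarrow> u = replicate e 0"
proof (induction e arbitrary: u)
  case (Suc e)
  then show ?case by (auto simp: list_all2_Cons2)
qed simp

text \<open>Peeling equal outer runs off an even palindrome leaves an even palindrome, which drives
  the induction. The two letters behave differently. A deformation touching an outer run of D
  shortens it, so it dies when both full runs are stripped and has to be treated separately
  afterwards. A deformation using up the outer D next to a run of E lengthens that run, so it could
  survive the stripping and has to be excluded beforehand.\<close>

theorem fam_lie_null_zero:
  fixes h :: "bool list \<Rightarrow> 'a::field_char_0"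
  assumes "m \<noteq> []" "rev m = m" "even (length (enc m))" "\<delta> \<noteq> 0"
    and "lie_null h" "twisted h" "\<And>t. h t \<noteq> 0 \<Longrightarrow> t \<in> enc ` fam \<delta> m"
  shows "h t = 0"
  using assms
proof (induction "length (enc m)" arbitrary: m h t rule: less_induct)
  case less
  note pal = \<open>rev m = m\<close> and null = \<open>lie_null h\<close> and tw = \<open>twisted h\<close>
    and supp = less.prems(7)
  have hrev: "h (rev t) \<noteq> 0 \<longleftrightarrow> h t \<noteq> 0" for t using tw unfolding twisted_def by simp
  have "rev (enc m) = enc m" using enc_rev[of m] pal by simp
  from even_palindrome_count[OF less.prems(3) this, of True]
  have odd_m: "odd (length m)" using Suc_count_enc[OF \<open>m \<noteq> []\<close>] by (metis even_Suc)
  show ?case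
  proof (cases "hd m = 0")
    case False
    define a where "a = hd m"
    show ?thesis
    proof (cases "length m = 1")
      case True
      then have "fam \<delta> m = {}" unfolding fam_def by auto
      then show ?thesis using supp by blast
    next
      case False
      then obtain m1 where m1: "m = a # m1" "m1 \<noteq> []"
        using \<open>m \<noteq> []\<close> unfolding a_def by (cases m) auto
      have "last m1 = a"
        using m1 pal by (metis a_def hd_rev last_ConsR)
      then obtain mid where m: "m = a # mid @ [a]"
        using m1 append_butlast_last_id[OF m1(2)] by metis
      have mid: "mid \<noteq> []" "rev mid = mid" using odd_m pal unfolding m by auto
      have run: "i \<le> f \<and> j \<le> l \<and> t = replicate (f - i) False @ enc (0 # x @ [0]) @ replicate (l - j) False"
        if "replicate i False @ t @ replicate j False = enc (f # x @ [l])" for i j f l t x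
        using replicate_both_eq[OF that[unfolded enc_core[of f]] enc_core_ends] .
      have inner: "i = a \<and> t \<in> enc ` fam \<delta> (0 # mid @ [0])"
        if "h (replicate i False @ t @ replicate j False) \<noteq> 0" "i + j = 2 * a" for i j t
      proof -
        have "replicate i False @ t @ replicate j False \<in> enc ` fam \<delta> m"
          using that(1) by (rule supp)
        then obtain b where b: "b \<in> fam \<delta> m" "replicate i False @ t @ replicate j False = enc b"
          by blast
        show ?thesis
        proof (rule fam_ends[OF b(1)[unfolded m] mid(1)])
          fix y assume y: "b = a # y @ [a]" "0 # y @ [0] \<in> fam \<delta> (0 # mid @ [0])"
          from run[OF b(2)[unfolded y(1)]] that(2) have "i = a" "j = a"
            "t = enc (0 # y @ [0])" by auto
          then show ?thesis using y(2) by blast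
        next
          fix f p q c v assume y: "p \<noteq> 0" "f + p = a" "b = f # c # v @ [a]"
          with run[of i t j f "c # v" a] b(2) that(2) show ?thesis by auto
        next
          fix l p q c v assume y: "p \<noteq> 0" "l + p = a" "b = a # v @ [c, l]"
          with run[of i t j a "v @ [c]" l] b(2) that(2) show ?thesis by auto
        qed
      qed
      \<comment> \<open>Deformations leaving both outer \<open>D\<close>-runs intact are the only words surviving \<open>ad(D)\<^sup>2\<^sup>a\<close>.\<close>
      define h' where "h' t = h (replicate a False @ t @ replicate a False)" for t
      have h'0: "h' t = 0" for t
      proof (rule less.hyps[of "0 # mid @ [0]"])
        have len: "length (enc m) = length (enc (0 # mid @ [0])) + 2 * a"
          unfolding m enc_core[of a] by simp
        show "length (enc (0 # mid @ [0])) < length (enc m)" using len \<open>hd m \<noteq> 0\<close> a_def by simp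
        show "even (length (enc (0 # mid @ [0])))" using len less.prems(3) by simp
        show "rev (0 # mid @ [0]) = 0 # mid @ [0]" using mid by simp
        show "lie_null h'" unfolding h'_def
          by (rule lie_null_sandwich[OF null]) (use inner in force)
        show "twisted h'" unfolding h'_def by (rule twisted_sandwich[OF tw])
        show "t \<in> enc ` fam \<delta> (0 # mid @ [0])" if "h' t \<noteq> 0" for t
          using inner[OF that[unfolded h'_def]] by simp
      qed (use less.prems in simp_all)
      \<comment> \<open>For the others, take the shortest outer \<open>D\<close>-run: stripping it and then one \<open>E\<close> isolates a
        single word, which contains an odd number of letters \<open>E\<close> and hence is not exempt.\<close>
      define P where "P = {p. p \<noteq> 0 \<and> p \<le> a \<and> (\<exists>q b v. p + q = \<delta> \<and> mid = (b + q) # v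
          \<and> h (enc ((a - p) # b # v @ [a])) \<noteq> 0)}"
      have inP: "p \<in> P" if "p \<noteq> 0" "f + p = a" "p + q = \<delta>" "mid = (b + q) # v"
        "h (enc (f # b # v @ [a])) \<noteq> 0" for f p q b v
      proof -
        have "f = a - p" "p \<le> a" using that(2) by auto
        then show ?thesis using that unfolding P_def by blast
      qed
      show ?thesis
      proof (rule ccontr)
        assume "h t \<noteq> 0"
        have "P \<noteq> {}"
        proof -
          obtain b where b: "b \<in> fam \<delta> m" "t = enc b" using supp[OF \<open>h t \<noteq> 0\<close>] by blast
          show ?thesis
          proof (rule fam_ends[OF b(1)[unfolded m] mid(1)])
            fix y assume "b = a # y @ [a]"
            then have "h t = h' (enc (0 # y @ [0]))" unfolding h'_def b(2) using enc_core[of a y a] by simp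
            then show ?thesis using h'0 \<open>h t \<noteq> 0\<close> by simp
          next
            fix f p q c v
            assume "p \<noteq> 0" "f + p = a" "p + q = \<delta>" "mid = (c + q) # v" "b = f # c # v @ [a]"
            then have "p \<in> P" using \<open>h t \<noteq> 0\<close> b(2) inP by blast
            then show ?thesis by blast
          next
            fix l p q c v
            assume y: "p \<noteq> 0" "l + p = a" "p + q = \<delta>" "mid = v @ [c + q]" "b = a # v @ [c, l]"
            have "h (enc (rev b)) \<noteq> 0" using \<open>h t \<noteq> 0\<close> b(2) by (simp add: enc_rev hrev)
            moreover have "rev b = l # c # rev v @ [a]" using y(5) by simp
            moreover have "mid = (c + q) # rev v" using mid(2) y(4) by auto
            ultimately have "p \<in> P" using y(1-3) inP by metis
            then show ?thesis by blast
          qed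
        qed
        moreover have "finite P" by (rule finite_subset[of _ "{..a}"]) (auto simp: P_def)
        \<comment> \<open>The largest \<open>p\<close> belongs to the shortest run; \<open>p\<close>
          determines \<open>q\<close>, hence \<open>b\<close>, \<open>v\<close> and the
          word.\<close>
        ultimately have "Max P \<in> P" and Max: "\<And>p. p \<in> P \<Longrightarrow> p \<le> Max P" by auto
        then obtain p q b v where p: "p \<noteq> 0" "p \<le> a" "p + q = \<delta>" "mid = (b + q) # v"
          "h (enc ((a - p) # b # v @ [a])) \<noteq> 0" "p = Max P" unfolding P_def by blast
        define c where "c = a - p"
        define s where "s = enc (b # v @ [a])"
        have key: "i = c \<and> t = s"
          if "i \<le> c" "h (replicate i False @ (True # t) @ replicate (c - i) False) \<noteq> 0" for i t
        proof -
          have "replicate i False @ (True # t) @ replicate (c - i) False \<in> enc ` fam \<delta> m"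
            using that(2) by (rule supp)
          then obtain b' where b': "b' \<in> fam \<delta> m"
            "replicate i False @ (True # t) @ replicate (c - i) False = enc b'" by blast
          have eq_i: "i = f" if "b' = f # x @ [l]" for f x l
          proof -
            from run[OF b'(2)[unfolded that]] have "i \<le> f"
              "True # t = replicate (f - i) False @ enc (0 # x @ [0]) @ replicate (l - (c - i)) False"
              by auto
            then show ?thesis by (cases "f - i") auto
          qed
          show ?thesis
          proof (rule fam_ends[OF b'(1)[unfolded m] mid(1)])
            fix y assume "b' = a # y @ [a]"
            from eq_i[OF this] that(1) p(1,2) show ?thesis by (simp add: c_def)
          next
            fix l p' q c' v' assume "b' = a # v' @ [c', l]"
            then have "b' = a # (v' @ [c']) @ [l]" by simp
            from eq_i[OF this] that(1) p(1,2) show ?thesis by (simp add: c_def)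
          next
            fix f p' q' c' v'
            assume y: "p' \<noteq> 0" "f + p' = a" "p' + q' = \<delta>" "mid = (c' + q') # v'"
              "b' = f # c' # v' @ [a]"
            then have "i = f" using eq_i[of f "c' # v'" a] by simp
            have "h (enc (f # c' # v' @ [a])) \<noteq> 0" using that(2) unfolding b'(2) y(5) .
            with y(1-4) have "p' \<in> P" by (rule inP)
            then have "p' \<le> p" using Max p(6) by simp
            then have "p' = p" "i = c" using y(2) \<open>i = f\<close> that(1) p(2) unfolding c_def by auto
            moreover from this have "q' = q" using y(3) p(3) by simp
            ultimately have "enc b' = replicate c False @ True # s"
              using y p(3,4) \<open>i = f\<close> by (simp add: s_def)
            then show ?thesis using b'(2) \<open>i = c\<close> by simp
          qed
        qed
        have "odd (count_list s True)"
        proof -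
          have "Suc (count_list s True) = length (b # v @ [a])" unfolding s_def
            by (rule Suc_count_enc) simp
          then show ?thesis using odd_m p(4) by (simp add: m)
        qed
        then have np: "\<not> (even (length s) \<and> rev s = s)"
          using even_palindrome_count[of s True] by blast
        have "h (replicate c False @ True # s) \<noteq> 0" using p(5) by (simp add: s_def c_def)
        note conc = strip_br_concentrated[OF tw np this key]
        have "exempt s"
        proof (rule exempt_if_lie_null)
          show "lie_null (br (strip c False h) True)" "twisted (br (strip c False h) True)"
            using null tw by (simp_all add: lie_null_strip lie_null_br twisted_strip twisted_br)
          show "t = s \<or> t = rev s" if "br (strip c False h) True t \<noteq> 0" for t
            using conc(1) that by blast
          show "br (strip c False h) True s \<noteq> 0" using conc(2) by blast
        qed
        moreover have "True \<in> set s" using \<open>odd (count_list s True)\<close> by (metis count_notin even_zero)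
        moreover have "False \<in> set s"
        proof -
          have "last s = False" unfolding s_def by (rule last_enc) (use p(1,2) in auto)
          then show ?thesis using \<open>True \<in> set s\<close> by (metis empty_iff empty_set last_in_set)
        qed
        ultimately show False using np unfolding exempt_def by (metis in_set_replicate)
      qed
    qed
  next
    case True
    show ?thesis
    proof (cases "\<forall>z\<in>set m. z = 0")
      case True
      then have "sum_list m = 0" by (simp add: sum_list_eq_0_iff)
      with \<open>\<delta> \<noteq> 0\<close> fam_sum[of _ \<delta> m] have "x \<notin> fam \<delta> m" for x
        by (metis add_is_0)
      then show ?thesis using supp by blast
    next
      case False
      then obtain z where z: "z \<in> set m" "z \<noteq> 0" by blast
      obtain e u e' where m: "m = replicate e 0 @ u @ replicate e' 0"
        and u: "u \<noteq> []" "hd u \<noteq> 0" "last u \<noteq> 0" using outer_runs[OF z] .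
      have "replicate e' 0 @ rev u @ replicate e 0 = replicate e 0 @ u @ replicate e' 0"
        using pal by (simp add: m)
      from replicate_both_eq[OF this u] have e': "e' = e" and ru: "rev u = u" by auto
      have "e \<noteq> 0" using \<open>hd m = 0\<close> u(1,2) by (cases e) (auto simp: m)
      have enc_zeros: "enc (replicate e 0 @ x @ replicate e 0)
          = replicate e True @ enc x @ replicate e True" if "x \<noteq> []" for x
        using that by (simp add: enc_zeros_hd enc_zeros_last)
      have enc_m: "enc m = replicate e True @ enc u @ replicate e True"
        unfolding m e' using u(1) by (rule enc_zeros)
      show ?thesis
      proof (cases "length u = 1")
        case True
        then obtain b where ub: "u = [b]" by (metis One_nat_def length_0_conv length_Suc_conv)
        \<comment> \<open>There is only one run of D, so every deformation shortens it by \<delta>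
          and gives the same palindrome. By twisting, a nonzero value there forces odd length, so
          the word is not exempt.\<close>
        have form: "t = replicate e True @ replicate (b - \<delta>) False @ replicate e True"
          if "h t \<noteq> 0" for t
        proof -
          have "t \<in> enc ` fam \<delta> m" using that by (rule supp)
          then obtain x where x: "x \<in> fam \<delta> m" "t = enc x" by blast
          from fam_le[OF x(1)] obtain x1 y where "x = x1 @ y"
            "list_all2 (\<le>) x1 (replicate e 0)" "list_all2 (\<le>) y (b # replicate e 0)"
            unfolding m e' ub by (auto simp: list_all2_append2)
          then obtain z where z: "x = replicate e 0 @ [z] @ replicate e 0"
            by (auto simp: list_all2_Cons2 dest!: list_all2_le_zeros)
          have "z + \<delta> = b" using fam_sum[OF x(1)] by (simp add: z m e' ub)
          then show ?thesis using enc_zeros[of "[z]"] by (simp add: x(2) z)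
        qed
        show ?thesis
        proof (rule ccontr)
          assume ht: "h t \<noteq> 0"
          note t = form[OF ht]
          have "rev t = t" by (simp add: t)
          moreover have "h (rev t) = - ((- 1) ^ length t * h t)"
            using tw unfolding twisted_def by blast
          ultimately have odd: "odd (length t)" using ht by (auto simp: minus_one_power_iff)
          have "exempt t"
            by (rule exempt_if_lie_null[OF null tw _ ht]) (metis form t)
          moreover have "True \<in> set t" "False \<in> set t"
            using \<open>e \<noteq> 0\<close> odd by (auto simp: t)
          ultimately show False using odd unfolding exempt_def by (metis in_set_replicate)
        qed
      next
        case False
        have "length m = 2 * e + length u" by (simp add: m e')
        then have "odd (length u)" using odd_m by simp
        moreover have "length u \<noteq> 0" using u(1) by simp
        ultimately have len3: "length u \<ge> 3" using False by presburger
        have len_x: "length x = length u" if "x \<in> fam \<delta> u" for x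
          using fam_le[OF that] by (rule list_all2_lengthD)
        have nonempty: "x \<noteq> []" if "x \<in> fam \<delta> u" for x
          using len_x[OF that] u(1) by auto
        have form: "\<exists>x\<in>fam \<delta> u. t = replicate e True @ enc x @ replicate e True"
          if "h t \<noteq> 0" for t
        proof -
          have "t \<in> enc ` fam \<delta> m" using that by (rule supp)
          then obtain x where x: "x \<in> fam \<delta> m" "t = enc x" by blast
          from fam_zeros[OF x(1)[unfolded m e']] len3 obtain y where "y \<in> fam \<delta> u"
            "x = replicate e 0 @ y @ replicate e 0" by auto
          then show ?thesis using enc_zeros[OF nonempty] x(2) by auto
        qed
        \<comment> \<open>If the deformation uses up the outermost \<open>D\<close>-run, the outer \<open>E\<close>-run gets longer. Up to
          reversal there is only one such word, and it is killed first.\<close>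
        have hd0: "h (replicate e True @ enc x @ replicate e True) = 0"
          if x: "x \<in> fam \<delta> u" "hd x = 0" for x
        proof (rule ccontr)
          define w where "w = replicate e True @ enc x @ replicate e True"
          assume "h (replicate e True @ enc x @ replicate e True) \<noteq> 0"
          then have hw: "h w \<noteq> 0" by (simp add: w_def)
          obtain b q v where bqv: "u = hd u # (b + q) # v" "hd u + q = \<delta>" "x = 0 # b # v" "v \<noteq> []"
            using fam_hd_zero[OF x(1) len3 u(2) x(2)] .
          have "last x \<noteq> 0" using bqv u(3) by (metis last.simps list.distinct(1))
          have uniq: "x' = x" if x': "x' \<in> fam \<delta> u" "hd x' = 0" for x'
          proof -
            obtain b' q' v' where "u = hd u # (b' + q') # v'" "hd u + q' = \<delta>" "x' = 0 # b' # v'"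
              using fam_hd_zero[OF x'(1) len3 u(2) x'(2)] .
            then show ?thesis using bqv by (metis add_left_cancel add_right_cancel list.inject)
          qed
          have "last x \<in> set x" using nonempty[OF x(1)] by simp
          obtain f y g where xy: "x = replicate f 0 @ y @ replicate g 0"
            and y: "y \<noteq> []" "hd y \<noteq> 0" "last y \<noteq> 0"
            using outer_runs[OF \<open>last x \<in> set x\<close> \<open>last x \<noteq> 0\<close>] .
          have "g = 0" using \<open>last x \<noteq> 0\<close> by (cases g) (auto simp: xy simp flip: replicate_append_same)
          have "f \<noteq> 0" using x(2) y(1,2) by (cases f) (auto simp: xy)
          define Y where "Y = enc y"
          have Y: "Y \<noteq> []" "hd Y \<noteq> True" "last Y \<noteq> True"
            using hd_enc[OF y(2,1)] last_enc[OF y(3,1)] by (simp_all add: Y_def)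
          have rY: "rev Y \<noteq> []" "hd (rev Y) \<noteq> True" "last (rev Y) \<noteq> True"
            using Y by (simp_all add: hd_rev last_rev)
          have enc_x: "enc x = replicate f True @ Y"
            unfolding xy Y_def \<open>g = 0\<close> using y(1) by (simp add: enc_zeros_hd)
          have w: "w = replicate (e + f) True @ Y @ replicate e True"
            by (simp add: w_def enc_x replicate_add)
          have rw: "rev w = replicate e True @ rev Y @ replicate (e + f) True"
            by (simp add: w)
          have cases3: "t = w \<or> t = rev w \<or> (\<exists>Z. Z \<noteq> [] \<and> hd Z \<noteq> True \<and> last Z \<noteq> True
              \<and> t = replicate e True @ Z @ replicate e True)" if ht: "h t \<noteq> 0" for t
          proof -
            obtain x' where x': "x' \<in> fam \<delta> u" "t = replicate e True @ enc x' @ replicate e True"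
              using form[OF ht] by blast
            consider "hd x' = 0" | "last x' = 0" | "hd x' \<noteq> 0" "last x' \<noteq> 0" by blast
            then show ?thesis
            proof cases
              case 1
              then show ?thesis using uniq[OF x'(1)] x'(2) w_def by simp
            next
              case 2
              have "rev x' \<in> fam \<delta> u" using fam_rev[OF x'(1)] ru by simp
              moreover have "hd (rev x') = 0" using 2 by (simp add: hd_rev)
              ultimately have "rev x' = x" by (rule uniq)
              then have "x' = rev x" by auto
              then have "rev w = t" by (simp add: w_def x'(2) enc_rev)
              then show ?thesis by blast
            next
              case 3
              then show ?thesis
                using hd_enc[OF 3(1) nonempty[OF x'(1)]] last_enc[OF 3(2) nonempty[OF x'(1)]] x'(2)
                by blast
            qed
          qed
          \<comment> \<open>The remaining words of the support have outer runs of exactly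
            \<open>e\<close> letters E, so removing more than \<open>2 * e\<close> of these letters
            leaves only \<open>w\<close> and its reverse.\<close>
          have key: "(i \<le> e + f \<and> j \<le> e \<and> t = replicate (e + f - i) True @ Y @ replicate (e - j) True)
              \<or> (i \<le> e \<and> j \<le> e + f \<and> t = replicate (e - i) True @ rev Y @ replicate (e + f - j) True)"
            if "h (replicate i True @ t @ replicate j True) \<noteq> 0" "i + j > 2 * e" for i j t
            using cases3[OF that(1)]
          proof (elim disjE exE conjE)
            assume "replicate i True @ t @ replicate j True = w"
            from replicate_both_eq[OF this[unfolded w] Y] show ?thesis by blast
          next
            assume "replicate i True @ t @ replicate j True = rev w"
            from replicate_both_eq[OF this[unfolded rw] rY] show ?thesis by blast
          next
            fix Z assume Z: "Z \<noteq> []" "hd Z \<noteq> True" "last Z \<noteq> True"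
              "replicate i True @ t @ replicate j True = replicate e True @ Z @ replicate e True"
            from replicate_both_eq[OF Z(4,1-3)] that(2) show ?thesis by auto
          qed
          show False
          proof (cases "exempt Y")
            case False
            then have np: "\<not> (even (length Y) \<and> rev Y = Y)" unfolding exempt_def by blast
            have key': "(i = e + f \<and> t = Y) \<or> (i = e \<and> t = rev Y)"
              if "i \<le> e + f + e" "h (replicate i True @ t @ replicate (e + f + e - i) True) \<noteq> 0"
              for i t
              using key[OF that(2)] that(1) \<open>f \<noteq> 0\<close> by auto
            note conc = strip_concentrated[OF tw np hw[unfolded w] key']
            have "exempt Y"
            proof (rule exempt_if_lie_null)
              show "lie_null (strip (e + f + e) True h)" "twisted (strip (e + f + e) True h)"
                using null tw by (simp_all add: lie_null_strip twisted_strip)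
              show "t = Y \<or> t = rev Y" if "strip (e + f + e) True h t \<noteq> 0" for t
                using conc(1) that by blast
              show "strip (e + f + e) True h Y \<noteq> 0" using conc(2) by blast
            qed
            with False show False ..
          next
            case True
            have rY: "rev Y = Y" using exempt_palindrome[OF True] .
            \<comment> \<open>Now one E is to be left next to \<open>Y\<close>. This means stripping
              \<open>2 * e + f - 1\<close> letters, which exceeds \<open>2 * e\<close> only for
              \<open>f\<close> at least 2. For \<open>f = 1\<close> the number of E in
              \<open>Y\<close> would be odd, although \<open>Y\<close> is exempt and contains
              D.\<close>
            have "f \<noteq> 1"
            proof
              assume "f = 1"
              have "Suc (count_list (enc x) True) = length x"
                using nonempty[OF x(1)] by (rule Suc_count_enc)
              then have odd: "odd (count_list Y True)"
                using \<open>odd (length u)\<close> len_x[OF x(1)] unfolding enc_x \<open>f = 1\<close>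
                by simp presburger
              then have "True \<in> set Y" by (metis count_notin even_zero)
              moreover have "hd Y = False" using Y by simp
              then have "False \<in> set Y" using Y(1) by (metis hd_in_set)
              ultimately have "even (length Y)"
                using True unfolding exempt_def by (metis in_set_replicate)
              with even_palindrome_count[OF this rY] odd show False by blast
            qed
            then have f: "f \<ge> 2" using \<open>f \<noteq> 0\<close> by simp
            define c where "c = 2 * e + f - 1"
            define g where "g = strip c True h"
            have tw_g: "twisted g" and null_g: "lie_null g"
              unfolding g_def using tw null by (simp_all add: twisted_strip lie_null_strip)
            have key': "(i = e + f - 1 \<and> t = True # Y) \<or> (i = e + f \<and> t = Y @ [True])
                \<or> (i = e - 1 \<and> t = True # Y) \<or> (i = e \<and> t = Y @ [True])"
              if hi: "h (replicate i True @ t @ replicate (c - i) True) \<noteq> 0" and "i \<le> c" for i t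
            proof -
              have c: "i + (c - i) = c" "c > 2 * e" using \<open>i \<le> c\<close> f unfolding c_def by auto
              from key[OF hi] consider
                "i \<le> e + f" "c - i \<le> e" "t = replicate (e + f - i) True @ Y @ replicate (e - (c - i)) True"
              | "i \<le> e" "c - i \<le> e + f" "t = replicate (e - i) True @ Y @ replicate (e + f - (c - i)) True"
                unfolding rY using c by auto
              then show ?thesis
              proof cases
                case 1
                then consider "i = e + f - 1" | "i = e + f" using c_def \<open>i \<le> c\<close> f by linarith
                then show ?thesis
                proof cases
                  case i: 1
                  then have "e + f - i = 1" "e - (c - i) = 0" using f c_def by auto
                  then show ?thesis using 1(3) i by simp
                next
                  case i: 2
                  then have "e + f - i = 0" "e - (c - i) = 1" using f c_def \<open>e \<noteq> 0\<close> by auto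
                  then show ?thesis using 1(3) i by simp
                qed
              next
                case 2
                then consider "i = e - 1" | "i = e" using c_def \<open>i \<le> c\<close> f by linarith
                then show ?thesis
                proof cases
                  case i: 1
                  then have "e - i = 1" "e + f - (c - i) = 0" using f c_def \<open>e \<noteq> 0\<close> by auto
                  then show ?thesis using 2(3) i by simp
                next
                  case i: 2
                  then have "e - i = 0" "e + f - (c - i) = 1" using f c_def by auto
                  then show ?thesis using 2(3) i by simp
                qed
              qed
            qed
            have "Y @ [True] \<noteq> True # Y" using Y by (metis hd_append2 list.sel(1))
            have "g (True # Y) = (- 1) ^ (e + f - 1) * of_nat (c choose (e + f - 1))
                * h (replicate (e + f - 1) True @ (True # Y) @ replicate (c - (e + f - 1)) True)
                + (- 1) ^ (e - 1) * of_nat (c choose (e - 1))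
                * h (replicate (e - 1) True @ (True # Y) @ replicate (c - (e - 1)) True)"
              unfolding g_def
            proof (rule strip_two)
              show "i = e + f - 1 \<or> i = e - 1"
                if "i \<le> c" "h (replicate i True @ (True # Y) @ replicate (c - i) True) \<noteq> 0" for i
                using key'[OF that(2,1)] \<open>Y @ [True] \<noteq> True # Y\<close> by metis
            qed (use f \<open>e \<noteq> 0\<close> in \<open>auto simp: c_def\<close>)
            moreover have "replicate (e + f - 1) True @ (True # Y) @ replicate (c - (e + f - 1)) True = w"
            proof -
              have "e + f = Suc (e + f - 1)" "c - (e + f - 1) = e" using f by (auto simp: c_def)
              then show ?thesis unfolding w by (metis append_Cons append_assoc replicate_Suc replicate_app_Cons_same)
            qed
            moreover have "replicate (e - 1) True @ (True # Y) @ replicate (c - (e - 1)) True = rev w"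
            proof -
              have "e = Suc (e - 1)" "c - (e - 1) = e + f" using f \<open>e \<noteq> 0\<close> by (auto simp: c_def)
              then show ?thesis unfolding rw rY
                by (metis append_Cons append_assoc replicate_Suc replicate_app_Cons_same)
            qed
            moreover have "c choose (e + f - 1) = c choose e"
              using binomial_symmetric[of e c] f by (simp add: c_def algebra_simps)
            ultimately have gval: "g (True # Y) = (- 1) ^ (e + f - 1) * of_nat (c choose e) * h w
                + (- 1) ^ (e - 1) * of_nat (c choose (e - 1)) * h (rev w)" by simp
            \<comment> \<open>Both \<open>w\<close> and its reverse contribute to
              \<open>g (True # Y)\<close>. The two coefficients are distinct because
              \<open>e\<close> is at most \<open>c div 2\<close>, so no choice of signs makes the
              contributions cancel.\<close>
            have less: "c choose (e - 1) < c choose e"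
              by (rule binomial_strict_mono) (use f \<open>e \<noteq> 0\<close> in \<open>auto simp: c_def\<close>)
            have "g (True # Y) \<noteq> 0"
            proof -
              have "h (rev w) = h w \<or> h (rev w) = - h w"
                using tw unfolding twisted_def by (auto simp: minus_one_power_iff)
              moreover have "(of_nat (c choose e) :: 'a) \<noteq> of_nat (c choose (e - 1))"
                using less by simp
              moreover have "(of_nat (c choose e) :: 'a) + of_nat (c choose (e - 1)) \<noteq> 0"
                using less by (metis add_is_0 of_nat_add of_nat_eq_0_iff not_less_zero)
              ultimately show ?thesis using hw unfolding gval
                by (intro signed_sum_nonzero) (auto simp: minus_one_power_iff)
            qed
            moreover have "t = True # Y \<or> t = rev (True # Y)" if "g t \<noteq> 0" for t
              using strip_nonzero[OF that[unfolded g_def]] key' rY by (metis rev.simps(2))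
            ultimately have "exempt (True # Y)"
              by (intro exempt_if_lie_null[OF null_g tw_g])
            moreover have "\<not> exempt (True # Y)"
              using Y by (intro not_exempt_hd_last) auto
            ultimately show False by blast
          qed
        qed
        have ends: "\<exists>x\<in>fam \<delta> u. hd x \<noteq> 0 \<and> last x \<noteq> 0 \<and> t = replicate e True @ enc x @ replicate e True"
          if ht: "h t \<noteq> 0" for t
        proof -
          obtain x where x: "x \<in> fam \<delta> u" "t = replicate e True @ enc x @ replicate e True"
            using form[OF ht] by blast
          have "hd x \<noteq> 0" using hd0[OF x(1)] ht x(2) by blast
          moreover have "last x \<noteq> 0"
          proof
            assume "last x = 0"
            then have "hd (rev x) = 0" by (simp add: hd_rev)
            moreover have "rev x \<in> fam \<delta> u" using fam_rev[OF x(1)] ru by simp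
            ultimately have "h (replicate e True @ enc (rev x) @ replicate e True) = 0" using hd0 by blast
            then have "h (rev t) = 0" by (simp add: x(2) enc_rev)
            then show False using hrev ht by blast
          qed
          ultimately show ?thesis using x by blast
        qed
        have inner: "i = e \<and> t \<in> enc ` fam \<delta> u"
          if hi: "h (replicate i True @ t @ replicate j True) \<noteq> 0" and ij: "i + j = 2 * e" for i j t
        proof -
          obtain x where x: "x \<in> fam \<delta> u" "hd x \<noteq> 0" "last x \<noteq> 0"
            "replicate i True @ t @ replicate j True = replicate e True @ enc x @ replicate e True"
            using ends[OF hi] by blast
          have "enc x \<noteq> []" "hd (enc x) \<noteq> True" "last (enc x) \<noteq> True"
            using hd_enc[OF x(2)] last_enc[OF x(3)] nonempty[OF x(1)] by auto
          from replicate_both_eq[OF x(4) this] ij have "i = e" "t = enc x" by auto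
          then show ?thesis using x(1) by blast
        qed
        define h' where "h' t = h (replicate e True @ t @ replicate e True)" for t
        have "h' t = 0" for t
        proof (rule less.hyps[of u])
          show "length (enc u) < length (enc m)" using \<open>e \<noteq> 0\<close> by (simp add: enc_m)
          have "length (enc m) = 2 * e + length (enc u)" by (simp add: enc_m)
          then show "even (length (enc u))" using less.prems(3) by simp
          show "lie_null h'" unfolding h'_def
            by (rule lie_null_sandwich[OF null]) (use inner in force)
          show "twisted h'" unfolding h'_def by (rule twisted_sandwich[OF tw])
          show "t \<in> enc ` fam \<delta> u" if "h' t \<noteq> 0" for t
            using inner[OF that[unfolded h'_def]] by simp
        qed (use u ru less.prems in simp_all)
        then show ?thesis using form[of t] unfolding h'_def by metis
      qed
    qed
  qed
qed

section \<open>Corner entries of words in two matrices\<close>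

lemma foldl_br_diff: "foldl br (\<lambda>t. f t - g t) xs = (\<lambda>t. foldl br f xs t - foldl br g xs t)"
proof (induction xs arbitrary: f g)
  case (Cons x xs)
  have "br (\<lambda>t. f t - g t) x = (\<lambda>t. br f x t - br g x t)"
    by (rule ext) (simp add: br_def)
  then show ?case by (simp add: Cons.IH)
qed simp

text \<open>Reversal interchanges the two terms of \<open>br\<close>; the sign coming from the extra
  letter compensates.\<close>

lemma foldl_br_rev:
  "foldl br (\<lambda>t. (- 1) ^ length t * f (rev t)) xs = (\<lambda>t. (- 1) ^ length t * foldl br f xs (rev t))"
proof (induction xs arbitrary: f)
  case (Cons x xs)
  have "br (\<lambda>t. (- 1) ^ length t * f (rev t)) x = (\<lambda>t. (- 1) ^ length t * br f x (rev t))"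
    by (rule ext) (simp add: br_def algebra_simps)
  then show ?case by (simp add: Cons.IH)
qed simp

lemma foldl_br_length:
  "foldl br (\<lambda>t. if length t = n then f t else 0) xs
    = (\<lambda>t. if length t + length xs = n then foldl br f xs t else 0)"
proof (induction xs rule: rev_induct)
  case (snoc x xs)
  have "br (\<lambda>t. if length t + length xs = n then g t else 0) x
      = (\<lambda>t. if length t + length (xs @ [x]) = n then br g x t else 0)" for g :: "'a list \<Rightarrow> 'b"
    by (rule ext) (simp add: br_def)
  then show ?case by (simp only: foldl_append foldl_Cons foldl_Nil snoc)
qed (auto simp: fun_eq_iff)

text \<open>Homogeneous parts and signed reversals of a functional vanishing on Lie polynomials
  vanish there as well. For the corner functional of (D, E), the subtracted term is that of (D,
  phi(E)), see \<open>word_mat_corner\<close>.\<close>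

lemma lie_null_antisym:
  assumes "lie_null f"
  shows "lie_null (\<lambda>t. if length t = n then f t - (- 1) ^ length t * f (rev t) else 0)"
  using assms unfolding lie_null_def foldl_br_length foldl_br_diff foldl_br_rev by simp

lemma twisted_antisym:
  "twisted (\<lambda>t. if length t = n then f t - (- 1) ^ length t * f (rev t) else 0)"
  unfolding twisted_def by (auto simp: algebra_simps simp flip: power_add)

section \<open>Words evaluated at matrices\<close>

primrec word_mat :: "nat \<Rightarrow> ('b \<Rightarrow> 'a::field mat) \<Rightarrow> 'b list \<Rightarrow> 'a mat" where
  "word_mat n M [] = 1\<^sub>m n"
| "word_mat n M (x # w) = M x * word_mat n M w"

lemma word_mat_carrier:
  "(\<And>x. M x \<in> carrier_mat n n) \<Longrightarrow> word_mat n M w \<in> carrier_mat n n"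
  by (induction w) (auto intro!: mult_carrier_mat[where n = n])

lemma word_mat_append:
  assumes "\<And>x. M x \<in> carrier_mat n n"
  shows "word_mat n M (u @ v) = word_mat n M u * word_mat n M v"
proof (induction u)
  case Nil
  show ?case using word_mat_carrier[of M n v] assms by simp
next
  case (Cons x u)
  have "M x * (word_mat n M u * word_mat n M v) = (M x * word_mat n M u) * word_mat n M v"
    by (rule assoc_mult_mat[symmetric]) (rule assms word_mat_carrier[OF assms])+
  then show ?case by (simp add: Cons)
qed

lemma diff_diff_mat:
  fixes A :: "'a::ab_group_add mat"
  assumes "A \<in> carrier_mat n m" "B \<in> carrier_mat n m" "C \<in> carrier_mat n m" "D \<in> carrier_mat n m"
  shows "(A - B) - (C - D) = (A - C) - (B - D)"
  by (rule eq_matI) (use assms in auto)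

text \<open>Reading off an entry is linear, so \<open>br\<close> on words becomes the commutator of
  matrices. The order is that of \<open>foldr\<close>: the last letter of the list is bracketed
  first.\<close>

lemma foldl_br_word_mat:
  fixes M :: "'b \<Rightarrow> 'a::field_char_0 mat"
  assumes M: "\<And>x. M x \<in> carrier_mat n n" and ij: "i < n" "j < n"
  shows "foldl br (\<lambda>t. word_mat n M t $$ (i, j)) xs t
    = foldr (\<lambda>x B. lie_bracket B (M x)) xs (word_mat n M t) $$ (i, j)"
proof -
  have carr: "foldr (\<lambda>x B. lie_bracket B (M x)) xs A \<in> carrier_mat n n"
    if "A \<in> carrier_mat n n" for xs A
    using that by (induction xs) (auto simp: lie_bracket_def intro!: minus_carrier_mat
        mult_carrier_mat[where n = n] M)
  have minus: "foldr (\<lambda>x B. lie_bracket B (M x)) xs (A - B)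
      = foldr (\<lambda>x B. lie_bracket B (M x)) xs A - foldr (\<lambda>x B. lie_bracket B (M x)) xs B"
    if AB: "A \<in> carrier_mat n n" "B \<in> carrier_mat n n" for xs A B
  proof (induction xs)
    case (Cons x xs)
    define A' where "A' = foldr (\<lambda>x B. lie_bracket B (M x)) xs A"
    define B' where "B' = foldr (\<lambda>x B. lie_bracket B (M x)) xs B"
    have c: "A' \<in> carrier_mat n n" "B' \<in> carrier_mat n n"
      unfolding A'_def B'_def using carr AB by blast+
    have "(A' - B') * M x = A' * M x - B' * M x" "M x * (A' - B') = M x * A' - M x * B'"
      using c M by (metis minus_mult_distrib_mat, metis mult_minus_distrib_mat)
    moreover have "A' * M x \<in> carrier_mat n n" "B' * M x \<in> carrier_mat n n"
      "M x * A' \<in> carrier_mat n n" "M x * B' \<in> carrier_mat n n"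
      using mult_carrier_mat c M by blast+
    ultimately have "lie_bracket (A' - B') (M x) = lie_bracket A' (M x) - lie_bracket B' (M x)"
      unfolding lie_bracket_def by (simp only: diff_diff_mat)
    then show ?case using Cons by (simp add: A'_def B'_def)
  qed simp
  show ?thesis
  proof (induction xs arbitrary: t rule: rev_induct)
    case (snoc x xs)
    define W where "W = word_mat n M t"
    have W: "W \<in> carrier_mat n n" unfolding W_def using M by (rule word_mat_carrier)
    have "word_mat n M (t @ [x]) = W * M x" "word_mat n M (x # t) = M x * W"
      using M[of x] by (simp_all add: word_mat_append[OF M] W_def)
    have "W * M x \<in> carrier_mat n n" "M x * W \<in> carrier_mat n n"
      using mult_carrier_mat W M by blast+
    then have "foldr (\<lambda>x B. lie_bracket B (M x)) xs (W * M x) $$ (i, j)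
        - foldr (\<lambda>x B. lie_bracket B (M x)) xs (M x * W) $$ (i, j)
        = foldr (\<lambda>x B. lie_bracket B (M x)) (xs @ [x]) W $$ (i, j)"
      using carr[of "W * M x" xs] carr[of "M x * W" xs] ij
      by (simp add: minus lie_bracket_def[of W "M x"])
    moreover have "foldl br (\<lambda>t. word_mat n M t $$ (i, j)) (xs @ [x]) t
        = foldl br (\<lambda>t. word_mat n M t $$ (i, j)) xs (t @ [x])
          - foldl br (\<lambda>t. word_mat n M t $$ (i, j)) xs (x # t)"
      by (simp add: br_def[where t = t])
    ultimately show ?case
      unfolding snoc using \<open>word_mat n M (t @ [x]) = W * M x\<close> \<open>word_mat n M (x # t) = M x * W\<close>
      by (simp only: W_def)
  qed simp
qed

section \<open>The map phi on products and on the corner entry\<close>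

lemma phi_carrier [simp]: "phi n A \<in> carrier_mat n n"
  by (simp add: phi_def)

lemma dim_phi [simp]: "dim_row (phi n A) = n" "dim_col (phi n A) = n"
  by (simp_all add: phi_def)

lemma phi_index:
  assumes "r < n" "c < n"
  shows "phi n A $$ (r, c) = (- 1) ^ (r + c + 1) * A $$ (n - 1 - c, n - 1 - r)"
proof -
  have powi: "(- 1 :: 'a) powi (int (r + 1) - int (c + 1) + 1) = (- 1) ^ (r + c + 1)"
  proof -
    define m where "m = int (r + 1) - int (c + 1) + 1"
    have "(- 1 :: 'a) powi (m + int (2 * c)) = (- 1) powi m * (- 1) powi int (2 * c)"
      by (rule power_int_add) simp
    moreover have "m + int (2 * c) = int (r + c + 1)" by (simp add: m_def)
    moreover have "(- 1 :: 'a) powi int (2 * c) = 1" by (simp only: power_int_of_nat) simp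
    ultimately have "(- 1 :: 'a) powi int (r + c + 1) = (- 1) powi m" by (metis mult_1_right)
    then show ?thesis by (simp only: power_int_of_nat m_def)
  qed
  show ?thesis
    unfolding phi_def using assms by (simp only: index_mat split_conv Let_def powi) simp
qed


lemma index_mult_mat_sum:
  assumes "A \<in> carrier_mat n n" "B \<in> carrier_mat n n" "r < n" "c < n"
  shows "(A * B) $$ (r, c) = (\<Sum>s<n. A $$ (r, s) * B $$ (s, c))"
  using assms by (auto simp: scalar_prod_def atLeast0LessThan intro!: sum.cong)

text \<open>Reflection in the antidiagonal reverses products, and the checkerboard signs along r, s,
  c multiply to that of r, c up to -1. This extra -1 is what makes phi respect commutators.\<close>

lemma phi_mult:
  fixes A B :: "'a::field mat"
  assumes "A \<in> carrier_mat n n" "B \<in> carrier_mat n n"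
  shows "phi n (A * B) = - (phi n B * phi n A)"
proof (rule eq_matI)
  fix r c assume "r < dim_row (- (phi n B * phi n A))" "c < dim_col (- (phi n B * phi n A))"
  then have rc: "r < n" "c < n" using phi_carrier[of n A] phi_carrier[of n B] by auto
  let ?t = "\<lambda>s. (- 1) ^ (r + c + 1) * (A $$ (n - 1 - c, s) * B $$ (s, n - 1 - r))"
  have 1: "phi n (A * B) $$ (r, c) = (\<Sum>s<n. ?t s)"
    using rc by (simp add: phi_index index_mult_mat_sum[OF assms] sum_distrib_left
        sum_negf mult.assoc)
  have "(phi n B * phi n A) $$ (r, c) = (\<Sum>s<n. phi n B $$ (r, s) * phi n A $$ (s, c))"
    using rc by (intro index_mult_mat_sum) auto
  also have "\<dots> = (\<Sum>s<n. - ?t (n - 1 - s))"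
  proof (rule sum.cong)
    fix s assume "s \<in> {..<n}"
    moreover have "(- 1 :: 'a) ^ (r + s + 1) * (- 1) ^ (s + c + 1) = - ((- 1) ^ (r + c + 1))"
      by (auto simp: minus_one_power_iff)
    ultimately show "phi n B $$ (r, s) * phi n A $$ (s, c) = - ?t (n - 1 - s)"
      using rc by (simp add: phi_index algebra_simps)
  qed simp
  also have "\<dots> = - (\<Sum>s<n. ?t (n - Suc s))" by (simp add: sum_negf)
  also have "(\<Sum>s<n. ?t (n - Suc s)) = (\<Sum>s<n. ?t s)" by (rule sum.nat_diff_reindex)
  finally have "(phi n B * phi n A) $$ (r, c) = - (phi n (A * B) $$ (r, c))"
    unfolding 1 .
  moreover have "(- (phi n B * phi n A)) $$ (r, c) = - ((phi n B * phi n A) $$ (r, c))"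
    using rc by (intro index_uminus_mat) simp_all
  ultimately show "phi n (A * B) $$ (r, c) = (- (phi n B * phi n A)) $$ (r, c)" by simp
qed simp_all

lemma phi_word_mat:
  fixes M :: "'b \<Rightarrow> 'a::field mat"
  assumes "\<And>x. M x \<in> carrier_mat n n"
  shows "phi n (word_mat n M (rev w)) = (- 1) ^ (length w + 1) \<cdot>\<^sub>m word_mat n (\<lambda>x. phi n (M x)) w"
proof (induction w)
  case Nil
  show ?case by (rule eq_matI) (auto simp: phi_index one_mat_def)
next
  case (Cons x w)
  let ?W = "word_mat n (\<lambda>x. phi n (M x)) w"
  have W: "?W \<in> carrier_mat n n" by (rule word_mat_carrier) simp
  have "phi n (word_mat n M (rev (x # w))) = phi n (word_mat n M (rev w) * M x)"
    using assms[of x] by (simp add: word_mat_append[OF assms])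
  also have "\<dots> = - (phi n (M x) * phi n (word_mat n M (rev w)))"
    by (rule phi_mult) (rule word_mat_carrier[OF assms] assms)+
  also have "\<dots> = - (phi n (M x) * ((- 1) ^ (length w + 1) \<cdot>\<^sub>m ?W))"
    by (simp only: Cons)
  also have "phi n (M x) * ((- 1) ^ (length w + 1) \<cdot>\<^sub>m ?W) = (- 1) ^ (length w + 1) \<cdot>\<^sub>m (phi n (M x) * ?W)"
    using W by (rule mult_smult_distrib[OF phi_carrier])
  finally show ?case by (intro eq_matI) auto
qed

text \<open>The reflection fixes the corner, where the sign of phi is (-1)^n = -1. This turns the
  factor (-1)^(|w|+1) of \<open>phi_word_mat\<close> into (-1)^|w|.\<close>

lemma word_mat_corner:
  fixes M :: "'b \<Rightarrow> 'a::field mat"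
  assumes "\<And>x. M x \<in> carrier_mat n n" "odd n"
  shows "word_mat n (\<lambda>x. phi n (M x)) w $$ (0, n - 1)
    = (- 1) ^ length w * word_mat n M (rev w) $$ (0, n - 1)"
proof -
  have n: "0 < n" "n - 1 < n" using odd_pos[OF assms(2)] by auto
  have W: "word_mat n (\<lambda>x. phi n (M x)) w \<in> carrier_mat n n" by (rule word_mat_carrier) simp
  have "phi n (word_mat n M (rev w)) $$ (0, n - 1) = (- 1) ^ n * word_mat n M (rev w) $$ (0, n - 1)"
    using n by (simp add: phi_index)
  also have "(- 1 :: 'a) ^ n = - 1" using assms(2) by simp
  finally have "(- 1) ^ (length w + 1) * word_mat n (\<lambda>x. phi n (M x)) w $$ (0, n - 1)
      = - word_mat n M (rev w) $$ (0, n - 1)"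
    unfolding phi_word_mat[OF assms(1)] using n W by simp
  then show ?thesis by (cases "even (length w)") (simp_all add: minus_equation_iff)
qed


section \<open>Products of strictly upper triangular matrices\<close>

lemma word_mat_below:
  assumes M: "\<And>x. M x \<in> carrier_mat n n"
    and upper: "\<And>x r c. r < n \<Longrightarrow> c \<le> r \<Longrightarrow> M x $$ (r, c) = 0"
    and "r < n" "c < n" "c < r + length w"
  shows "word_mat n M w $$ (r, c) = 0"
  using assms(3-5)
proof (induction w arbitrary: r)
  case (Cons x w)
  have "M x $$ (r, s) * word_mat n M w $$ (s, c) = 0" if "s < n" for s
  proof (cases "s \<le> r")
    case True
    then show ?thesis using upper[OF Cons.prems(1)] by simp
  next
    case False
    then show ?thesis using Cons that by simp
  qed
  then have "(\<Sum>s<n. M x $$ (r, s) * word_mat n M w $$ (s, c)) = 0"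
    by (intro sum.neutral) blast
  then show ?case
    using Cons.prems by (simp only: word_mat.simps index_mult_mat_sum[OF M word_mat_carrier[OF M]])
qed simp

lemma word_mat_diag:
  assumes M: "\<And>x. M x \<in> carrier_mat n n"
    and upper: "\<And>x r c. r < n \<Longrightarrow> c \<le> r \<Longrightarrow> M x $$ (r, c) = 0"
    and W: "Suc (length W) = n"
    and super: "\<And>x r. Suc r < n \<Longrightarrow> M x $$ (r, Suc r) = (if x = W ! r then 1 else 0)"
    and "r + length w < n"
  shows "word_mat n M w $$ (r, r + length w) = (if take (length w) (drop r W) = w then 1 else 0)"
  using assms(5)
proof (induction w arbitrary: r)
  case (Cons x w)
  have r: "Suc r < n" "r < length W" using Cons.prems W by auto
  have "M x $$ (r, s) * word_mat n M w $$ (s, r + length (x # w)) = 0"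
    if "s < n" "s \<noteq> Suc r" for s
  proof (cases "s \<le> r")
    case True
    then show ?thesis using upper r by simp
  next
    case False
    then show ?thesis using that Cons.prems
      by (simp add: word_mat_below[OF M upper])
  qed
  then have "word_mat n M (x # w) $$ (r, r + length (x # w))
      = (\<Sum>s\<in>{Suc r}. M x $$ (r, s) * word_mat n M w $$ (s, r + length (x # w)))"
    using Cons.prems r(1)
    by (simp add: index_mult_mat_sum[OF M word_mat_carrier[OF M]]
        sum.mono_neutral_right[of "{..<n}" "{Suc r}"])
  also have "\<dots> = M x $$ (r, Suc r) * word_mat n M w $$ (Suc r, Suc r + length w)" by simp
  also have "\<dots> = (if x = W ! r \<and> take (length w) (drop (Suc r) W) = w then 1 else 0)"
    using super[OF r(1)] Cons.IH[of "Suc r"] Cons.prems by simp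
  also have "\<dots> = (if take (length (x # w)) (drop r W) = x # w then 1 else 0)"
    using Cons_nth_drop_Suc[OF r(2)] by (auto simp flip: Cons_nth_drop_Suc[OF r(2)])
  finally show ?case .
qed simp

text \<open>Expand M A - M' B as (M - M') A + M' (A - B). A factor M - M' advances by at least 1 +
  \<delta> places, so at total distance \<open>length w + \<delta>\<close> exactly one factor makes
  such a jump, of minimal length, and all others follow W. The index \<open>j\<close> is the
  position of the jump; the letters r + j, ..., r + j + \<delta> of W are replaced by one E.\<close>

lemma
  fixes M M' :: "bool \<Rightarrow> 'a::field mat"
  assumes M: "\<And>x. M x \<in> carrier_mat n n" and M': "\<And>x. M' x \<in> carrier_mat n n"
    and upper: "\<And>x r c. r < n \<Longrightarrow> c \<le> r \<Longrightarrow> M x $$ (r, c) = 0"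
    and upper': "\<And>x r c. r < n \<Longrightarrow> c \<le> r \<Longrightarrow> M' x $$ (r, c) = 0"
    and W: "Suc (length W) = n"
    and super: "\<And>x r. Suc r < n \<Longrightarrow> M x $$ (r, Suc r) = (if x = W ! r then 1 else 0)"
    and super': "\<And>x r. Suc r < n \<Longrightarrow> M' x $$ (r, Suc r) = (if x = W ! r then 1 else 0)"
    and eq: "\<And>x r c. r < n \<Longrightarrow> c < n \<Longrightarrow> c < Suc (r + \<delta>) \<Longrightarrow> M x $$ (r, c) = M' x $$ (r, c)"
    and D: "M False = M' False"
  shows word_mat_diff_below: "\<And>r c. r < n \<Longrightarrow> c < n \<Longrightarrow> c < r + length w + \<delta>
      \<Longrightarrow> word_mat n M w $$ (r, c) = word_mat n M' w $$ (r, c)"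
    and word_mat_diff_diag: "\<And>r. Suc (r + length w + \<delta>) = n \<Longrightarrow>
      word_mat n M w $$ (r, n - 1) - word_mat n M' w $$ (r, n - 1)
      = (\<Sum>j<length w. if w = take j (drop r W) @ True # drop (Suc (r + j + \<delta>)) W
          then M True $$ (r + j, Suc (r + j + \<delta>)) - M' True $$ (r + j, Suc (r + j + \<delta>)) else 0)"
proof (induction w)
  case Nil
  show "word_mat n M [] $$ (r, c) = word_mat n M' [] $$ (r, c)" for r c by simp
  show "Suc (r + length [] + \<delta>) = n \<Longrightarrow> word_mat n M [] $$ (r, n - 1) - word_mat n M' [] $$ (r, n - 1)
      = (\<Sum>j<length []. if [] = take j (drop r W) @ True # drop (Suc (r + j + \<delta>)) W
          then M True $$ (r + j, Suc (r + j + \<delta>)) - M' True $$ (r + j, Suc (r + j + \<delta>)) else 0)" for r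
    by simp
next
  case (Cons x w)
  let ?A = "word_mat n M w" and ?B = "word_mat n M' w"
  note prod = index_mult_mat_sum[OF M word_mat_carrier[of M, OF M]]
    index_mult_mat_sum[OF M' word_mat_carrier[of M', OF M']]
  have diff: "word_mat n M (x # w) $$ (r, c) - word_mat n M' (x # w) $$ (r, c)
      = (\<Sum>s<n. (M x $$ (r, s) - M' x $$ (r, s)) * ?A $$ (s, c))
        + (\<Sum>s<n. M' x $$ (r, s) * (?A $$ (s, c) - ?B $$ (s, c)))"
    if "r < n" "c < n" for r c
    using that by (simp add: prod algebra_simps sum.distrib sum_subtractf)
  have left: "(M x $$ (r, s) - M' x $$ (r, s)) * ?A $$ (s, c) = 0"
    if "r < n" "c < n" "s < n" "s \<le> r + \<delta> \<or> c < s + length w" for r s c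
    using that eq[of r s x] word_mat_below[OF M upper, of s c w] by fastforce
  have right: "M' x $$ (r, s) * (?A $$ (s, c) - ?B $$ (s, c)) = 0"
    if "r < n" "c < n" "s < n" "s \<le> r \<or> c < s + length w + \<delta>" for r s c
    using that upper'[of r s x] Cons.IH(1)[of s c] by fastforce
  show "word_mat n M (x # w) $$ (r, c) = word_mat n M' (x # w) $$ (r, c)"
    if "r < n" "c < n" "c < r + length (x # w) + \<delta>" for r c
  proof -
    have "(\<Sum>s<n. (M x $$ (r, s) - M' x $$ (r, s)) * ?A $$ (s, c)) = 0"
    proof (intro sum.neutral ballI, rule left)
      show "s \<le> r + \<delta> \<or> c < s + length w" for s using that(3) by auto
    qed (use that in auto)
    moreover have "(\<Sum>s<n. M' x $$ (r, s) * (?A $$ (s, c) - ?B $$ (s, c))) = 0"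
    proof (intro sum.neutral ballI, rule right)
      show "s \<le> r \<or> c < s + length w + \<delta>" for s using that(3) by auto
    qed (use that in auto)
    ultimately show ?thesis using diff[OF that(1,2)] by simp
  qed
  show "word_mat n M (x # w) $$ (r, n - 1) - word_mat n M' (x # w) $$ (r, n - 1)
      = (\<Sum>j<length (x # w). if x # w = take j (drop r W) @ True # drop (Suc (r + j + \<delta>)) W
          then M True $$ (r + j, Suc (r + j + \<delta>)) - M' True $$ (r + j, Suc (r + j + \<delta>)) else 0)"
    if n: "Suc (r + length (x # w) + \<delta>) = n" for r
  proof -
    let ?Y = "\<lambda>r. M True $$ (r, Suc (r + \<delta>)) - M' True $$ (r, Suc (r + \<delta>))"
    have r: "Suc r < n" "r < length W" "r < n" "n - 1 < n" "Suc (r + \<delta>) < n" using n W by auto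
    have "(\<Sum>s<n. (M x $$ (r, s) - M' x $$ (r, s)) * ?A $$ (s, n - 1))
        = (\<Sum>s\<in>{Suc (r + \<delta>)}. (M x $$ (r, s) - M' x $$ (r, s)) * ?A $$ (s, n - 1))"
    proof (rule sum.mono_neutral_right, goal_cases)
      case 3
      show ?case
      proof (intro ballI, rule left)
        fix s assume "s \<in> {..<n} - {Suc (r + \<delta>)}"
        then show "s < n" "s \<le> r + \<delta> \<or> n - 1 < s + length w" using n by auto
      qed (use r in auto)
    qed (use r in auto)
    also have "\<dots> = (M x $$ (r, Suc (r + \<delta>)) - M' x $$ (r, Suc (r + \<delta>)))
        * ?A $$ (Suc (r + \<delta>), Suc (r + \<delta>) + length w)"
      using n by (simp add: algebra_simps flip: n)
    also have "\<dots> = (if x # w = True # drop (Suc (r + \<delta>)) W then ?Y r else 0)"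
    proof -
      have "take (length w) (drop (Suc (r + \<delta>)) W) = drop (Suc (r + \<delta>)) W"
        using n W by (intro take_all) simp
      moreover have "Suc (r + \<delta>) + length w < n" using n by simp
      ultimately have "?A $$ (Suc (r + \<delta>), Suc (r + \<delta>) + length w)
          = (if w = drop (Suc (r + \<delta>)) W then 1 else 0)"
        using word_mat_diag[OF M upper W super, of "Suc (r + \<delta>)" w] by auto
      then show ?thesis using D by (cases x) auto
    qed
    finally have 1: "(\<Sum>s<n. (M x $$ (r, s) - M' x $$ (r, s)) * ?A $$ (s, n - 1))
        = (if x # w = True # drop (Suc (r + \<delta>)) W then ?Y r else 0)" .
    have "(\<Sum>s<n. M' x $$ (r, s) * (?A $$ (s, n - 1) - ?B $$ (s, n - 1)))
        = (\<Sum>s\<in>{Suc r}. M' x $$ (r, s) * (?A $$ (s, n - 1) - ?B $$ (s, n - 1)))"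
    proof (rule sum.mono_neutral_right, goal_cases)
      case 3
      show ?case
      proof (intro ballI, rule right)
        fix s assume "s \<in> {..<n} - {Suc r}"
        then show "s < n" "s \<le> r \<or> n - 1 < s + length w + \<delta>" using n by auto
      qed (use r in auto)
    qed (use r in auto)
    also have "\<dots> = (if x = W ! r then ?A $$ (Suc r, n - 1) - ?B $$ (Suc r, n - 1) else 0)"
      using super'[OF r(1)] by simp
    also have "?A $$ (Suc r, n - 1) - ?B $$ (Suc r, n - 1)
        = (\<Sum>j<length w. if w = take j (drop (Suc r) W) @ True # drop (Suc (Suc r + j + \<delta>)) W
          then ?Y (Suc r + j) else 0)"
      using Cons.IH(2)[of "Suc r"] n by simp
    finally have 2: "(\<Sum>s<n. M' x $$ (r, s) * (?A $$ (s, n - 1) - ?B $$ (s, n - 1)))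
        = (\<Sum>j<length w. if x # w = take (Suc j) (drop r W) @ True # drop (Suc (r + Suc j + \<delta>)) W
          then ?Y (r + Suc j) else 0)"
      by (auto simp flip: Cons_nth_drop_Suc[OF r(2)] cong: if_cong)
    have "length (x # w) = Suc (length w)" by simp
    then show ?thesis
      unfolding diff[OF r(3,4)] 1 2
      by (simp only: sum.lessThan_Suc_shift take_0 append_Nil add_0_right)
  qed
qed

section \<open>Replacing windows of W by a single E\<close>

lemma unique_True_replicate:
  assumes "\<exists>!i. r \<le> i \<and> i \<le> r + \<delta> \<and> W ! i" "r + \<delta> < length W"
  obtains p q where "p + q = \<delta>"
    "W = take r W @ replicate p False @ True # replicate q False @ drop (Suc (r + \<delta>)) W"
proof -
  from assms(1) obtain i where i: "r \<le> i" "i \<le> r + \<delta>" "W ! i"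
    and uniq: "\<And>j. r \<le> j \<Longrightarrow> j \<le> r + \<delta> \<Longrightarrow> W ! j \<Longrightarrow> j = i" by blast
  have False_block: "take c (drop l W) = replicate c False"
    if "\<And>j. l \<le> j \<Longrightarrow> j < l + c \<Longrightarrow> \<not> W ! j" "l + c \<le> length W" for l c
    by (rule nth_equalityI) (use that in auto)
  have nW: "\<not> W ! j" if "r \<le> j" "j \<le> r + \<delta>" "j \<noteq> i" for j
    using uniq that by blast
  have "W = take i W @ W ! i # drop (Suc i) W"
    using i(2) assms(2) by (intro id_take_nth_drop) simp
  moreover have "take i W = take r W @ take (i - r) (drop r W)"
    using i(1) by (metis le_add_diff_inverse take_add)
  moreover have "take (i - r) (drop r W) = replicate (i - r) False"
    by (rule False_block, rule nW) (use i assms(2) in auto)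
  moreover have "drop (Suc i) W = take (r + \<delta> - i) (drop (Suc i) W) @ drop (Suc (r + \<delta>)) W"
    using i(2) append_take_drop_id[of "r + \<delta> - i" "drop (Suc i) W"] by simp
  moreover have "take (r + \<delta> - i) (drop (Suc i) W) = replicate (r + \<delta> - i) False"
    by (rule False_block, rule nW) (use i assms(2) in auto)
  ultimately have "W = take r W @ replicate (i - r) False @ True # replicate (r + \<delta> - i) False
      @ drop (Suc (r + \<delta>)) W"
    using i(3) by (metis append.assoc append_Cons)
  then show thesis using that[of "i - r" "r + \<delta> - i"] i by simp
qed

lemma ex1_eq: "\<exists>!i. P i \<Longrightarrow> P a \<Longrightarrow> P b \<Longrightarrow> a = b"
  by blast

text \<open>Comparing the two results letter by letter shows that W has period \<delta> between the
  windows and has E at \<open>j\<close> and at \<open>j' + \<delta>\<close>. If one window contains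
  a single E, its remaining letters are D, and periodicity carries them across the whole gap,
  rightwards from the first window or leftwards from the second.\<close>

lemma delete_eq_gap:
  assumes eq: "take j W @ True # drop (Suc (j + \<delta>)) W = take j' W @ True # drop (Suc (j' + \<delta>)) W"
    and "j < j'" "j' + \<delta> < length W"
    and uniq: "(\<exists>!i. j \<le> i \<and> i \<le> j + \<delta> \<and> W ! i) \<or> (\<exists>!i. j' \<le> i \<and> i \<le> j' + \<delta> \<and> W ! i)"
    and "\<delta> \<noteq> 0"
  shows "W ! j" "W ! (j' + \<delta>)" "\<And>t. j < t \<Longrightarrow> t < j' + \<delta> \<Longrightarrow> \<not> W ! t"
proof -
  define w where "w = take j W @ True # drop (Suc (j + \<delta>)) W"
  have w1: "w ! j" "\<And>t. j < t \<Longrightarrow> t + \<delta> < length W \<Longrightarrow> w ! t = W ! (t + \<delta>)"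
    using assms(2,3) unfolding w_def
    by (auto simp: nth_append nth_Cons' min_def add.commute Suc_diff_Suc)
  have w2: "w ! j'" "\<And>t. t < j' \<Longrightarrow> w ! t = W ! t"
    using assms(2,3) unfolding w_def eq
    by (auto simp: nth_append nth_Cons' min_def)
  show Wj: "W ! j" using w1(1) w2(2)[OF \<open>j < j'\<close>] by simp
  show Wj': "W ! (j' + \<delta>)" using w1(2)[OF assms(2,3)] w2(1) by simp
  have per: "W ! t = W ! (t + \<delta>)" if "j < t" "t < j'" for t
    using w1(2)[of t] w2(2)[of t] that assms(3) by simp
  from uniq show "\<not> W ! t" if "j < t" "t < j' + \<delta>" for t
  proof
    assume u: "\<exists>!i. j \<le> i \<and> i \<le> j + \<delta> \<and> W ! i"
    show ?thesis using that
    proof (induction t rule: less_induct)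
      case (less t)
      show ?case
      proof (cases "t \<le> j + \<delta>")
        case True
        then show ?thesis using ex1_eq[OF u, of t j] Wj less.prems by auto
      next
        case False
        then have "\<not> W ! (t - \<delta>)" using less.IH[of "t - \<delta>"] less.prems \<open>\<delta> \<noteq> 0\<close> by simp
        then show ?thesis using per[of "t - \<delta>"] False less.prems by simp
      qed
    qed
  next
    assume u: "\<exists>!i. j' \<le> i \<and> i \<le> j' + \<delta> \<and> W ! i"
    have "\<not> W ! (j' + \<delta> - s)" if "s \<noteq> 0" "j < j' + \<delta> - s" for s
      using that
    proof (induction s rule: less_induct)
      case (less s)
      show ?case
      proof (cases "s \<le> \<delta>")
        case True
        then have "j' \<le> j' + \<delta> - s" "j' + \<delta> - s \<noteq> j' + \<delta>" using less.prems by auto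
        then show ?thesis using ex1_eq[OF u, of "j' + \<delta> - s" "j' + \<delta>"] Wj' by auto
      next
        case False
        then have "j' + \<delta> - s + \<delta> = j' + \<delta> - (s - \<delta>)" "j' + \<delta> - s < j'" using less.prems by auto
        moreover have "\<not> W ! (j' + \<delta> - (s - \<delta>))"
          using less.IH[of "s - \<delta>"] less.prems False \<open>\<delta> \<noteq> 0\<close> by simp
        ultimately show ?thesis using per[of "j' + \<delta> - s"] less.prems by simp
      qed
    qed
    from this[of "j' + \<delta> - t"] that show ?thesis by simp
  qed
qed

lemma nth_palindrome:
  assumes "Suc (length W) = n" "rev W = W" "Suc r < n"
  shows "W ! (n - Suc (Suc r)) = W ! r"
proof -
  have "rev W ! r = W ! (length W - Suc r)" using assms(1,3) by (intro rev_nth) simp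
  moreover have "length W - Suc r = n - Suc (Suc r)" using assms(1) by simp
  ultimately show ?thesis using assms(2) by simp
qed

text \<open>The reflection moves superdiagonal place r to n - 2 - r, where W has the same letter,
  and the sign of phi on the superdiagonal is +1.\<close>

lemma phi_partial_shift:
  fixes D :: "'a::field mat"
  assumes carr: "D \<in> carrier_mat n n" and W: "Suc (length W) = n" "rev W = W"
    and D: "\<And>r c. r < n \<Longrightarrow> c < n \<Longrightarrow> D $$ (r, c) = (if c = Suc r \<and> \<not> W ! r then 1 else 0)"
  shows "phi n D = D"
proof (rule eq_matI)
  fix r c assume "r < dim_row D" "c < dim_col D"
  then have rc: "r < n" "c < n" using carr by auto
  show "phi n D $$ (r, c) = D $$ (r, c)"
  proof (cases "c = Suc r")
    case True
    then have "D $$ (n - 1 - c, n - 1 - r) = D $$ (r, c)"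
      using rc nth_palindrome[OF W, of r] D by auto
    then show ?thesis using phi_index[OF rc, of D] True by simp
  next
    case False
    then have "n - 1 - r \<noteq> Suc (n - 1 - c)" using rc by auto
    then show ?thesis using phi_index[OF rc, of D] rc False D by simp
  qed
qed (use carr in auto)

text \<open>An entry (r, c) of E replaces the letters r, ..., c - 1 of W by one E. By
  \<open>E_one\<close> a nonzero entry does so to exactly one letter E and some D, which gives an
  element of \<open>fam\<close>. \<open>E_norm\<close> is weak normalization expressed by positions
  in W.\<close>

theorem phi_fixed_if_lie_null:
  fixes D E :: "'a::field_char_0 mat"
  assumes carr: "D \<in> carrier_mat n n" "E \<in> carrier_mat n n"
    and W: "Suc (length W) = n" "rev W = W" and "odd n"
    and D: "\<And>r c. r < n \<Longrightarrow> c < n \<Longrightarrow> D $$ (r, c) = (if c = Suc r \<and> \<not> W ! r then 1 else 0)"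
    and E_low: "\<And>r c. r < n \<Longrightarrow> c \<le> r \<Longrightarrow> E $$ (r, c) = 0"
    and E_super: "\<And>r. Suc r < n \<Longrightarrow> E $$ (r, Suc r) = (if W ! r then 1 else 0)"
    and E_one: "\<And>r c. r < n \<Longrightarrow> c < n \<Longrightarrow> E $$ (r, c) \<noteq> 0 \<Longrightarrow> \<exists>!i. r \<le> i \<and> i < c \<and> W ! i"
    and E_norm: "\<And>r s \<delta>. r + \<delta> < s \<Longrightarrow> Suc s < n \<Longrightarrow> W ! r \<Longrightarrow> W ! s \<Longrightarrow>
      (\<And>t. r < t \<Longrightarrow> t < s \<Longrightarrow> \<not> W ! t) \<Longrightarrow> E $$ (r, Suc (r + \<delta>)) = E $$ (s - \<delta>, Suc s)"
    and null: "lie_null (\<lambda>w. word_mat n (\<lambda>x. if x then E else D) w $$ (0, n - 1))"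
  shows "phi n E = E"
proof -
  define E' where "E' = phi n E"
  define F where "F w = word_mat n (\<lambda>x. if x then E else D) w $$ (0, n - 1)" for w
  have M: "(if x then E else D) \<in> carrier_mat n n" for x using carr by simp
  have E'_carr: "E' \<in> carrier_mat n n" by (simp add: E'_def)
  note flip = nth_palindrome[OF W]
  have E': "E' $$ (r, c) = (- 1) ^ (r + c + 1) * E $$ (n - 1 - c, n - 1 - r)" if "r < n" "c < n" for r c
    unfolding E'_def using that by (rule phi_index)
  have E'_low: "E' $$ (r, c) = 0" if "r < n" "c \<le> r" for r c
    using that E' E_low by simp
  have E'_super: "E' $$ (r, Suc r) = (if W ! r then 1 else 0)" if "Suc r < n" for r
  proof -
    have "E $$ (n - Suc (Suc r), n - Suc r) = (if W ! r then 1 else 0)"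
      using E_super[of "n - Suc (Suc r)"] flip[OF that] that by (simp add: Suc_diff_Suc)
    then show ?thesis using E'[of r "Suc r"] that by (simp add: power_add flip: power_mult_distrib)
  qed
  have E'_one: "\<exists>!i. r \<le> i \<and> i < c \<and> W ! i" if "r < n" "c < n" "E' $$ (r, c) \<noteq> 0" for r c
  proof -
    have "E $$ (n - 1 - c, n - 1 - r) \<noteq> 0" using E' that by simp
    then have "\<exists>!i. n - 1 - c \<le> i \<and> i < n - 1 - r \<and> W ! i"
      using that by (intro E_one) simp_all
    then obtain i where i: "n - 1 - c \<le> i" "i < n - 1 - r" "W ! i"
      and uniq: "\<And>j. n - 1 - c \<le> j \<Longrightarrow> j < n - 1 - r \<Longrightarrow> W ! j \<Longrightarrow> j = i" by blast
    show ?thesis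
    proof (rule ex1I[of _ "n - Suc (Suc i)"])
      show "r \<le> n - Suc (Suc i) \<and> n - Suc (Suc i) < c \<and> W ! (n - Suc (Suc i))"
        using i that flip[of i] by auto
      fix j assume j: "r \<le> j \<and> j < c \<and> W ! j"
      then have "n - Suc (Suc j) = i"
        using flip[of j] that by (intro uniq) auto
      then show "j = n - Suc (Suc i)" using j that by auto
    qed
  qed
  have E'_norm: "E' $$ (r, Suc (r + \<delta>)) = E' $$ (s - \<delta>, Suc s)"
    if "r + \<delta> < s" "Suc s < n" "W ! r" "W ! s" "\<And>t. r < t \<Longrightarrow> t < s \<Longrightarrow> \<not> W ! t" for r s \<delta>
  proof -
    define r' where "r' = n - Suc (Suc s)"
    define s' where "s' = n - Suc (Suc r)"
    have rs: "r' + \<delta> < s'" "Suc s' < n" using that(1,2) by (auto simp: r'_def s'_def)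
    have "E $$ (r', Suc (r' + \<delta>)) = E $$ (s' - \<delta>, Suc s')"
    proof (rule E_norm[OF rs])
      show "W ! r'" "W ! s'" using flip[of s] flip[of r] that by (auto simp: r'_def s'_def)
      fix t assume "r' < t" "t < s'"
      then have "r < n - Suc (Suc t)" "n - Suc (Suc t) < s" "Suc t < n"
        using that(1,2) by (auto simp: r'_def s'_def)
      then show "\<not> W ! t" using that(5) flip[of t] by auto
    qed
    moreover have "n - 1 - Suc (r + \<delta>) = s' - \<delta>" "n - 1 - r = Suc s'" "n - 1 - Suc s = r'"
      "n - 1 - (s - \<delta>) = Suc (r' + \<delta>)" "even (r + Suc (r + \<delta>)) = even (s - \<delta> + Suc s)"
      using that(1,2) by (auto simp: r'_def s'_def)
    ultimately show ?thesis using E'[of r "Suc (r + \<delta>)"] E'[of "s - \<delta>" "Suc s"] that(1,2)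
      by (simp add: minus_one_power_iff)
  qed
  have "phi n D = D"
    using carr(1) W D by (rule phi_partial_shift)
  then have phi_M: "phi n (if x then E else D) = (if x then E' else D)" for x by (simp add: E'_def)
  have M': "(if x then E' else D) \<in> carrier_mat n n" for x using carr E'_carr by simp
  have F': "word_mat n (\<lambda>x. if x then E' else D) w $$ (0, n - 1) = (- 1) ^ length w * F (rev w)" for w
    using word_mat_corner[of "\<lambda>x. if x then E else D" n w] M \<open>odd n\<close> unfolding phi_M F_def by blast
  have main: "\<forall>r. Suc (r + \<delta>) < n \<longrightarrow> E $$ (r, Suc (r + \<delta>)) = E' $$ (r, Suc (r + \<delta>))" for \<delta>
  proof (induction \<delta> rule: less_induct)
    case (less \<delta>)
    show ?case
    proof (cases "\<delta> = 0 \<or> n \<le> Suc \<delta>")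
      case True
      then show ?thesis using E_super E'_super by auto
    next
      case False
      then have \<delta>: "\<delta> \<noteq> 0" "Suc \<delta> < n" by auto
      \<comment> \<open>By \<open>word_mat_diff_below\<close> and the induction hypothesis,
        \<open>L\<close> is the greatest word length at which the two corner functionals can
        differ.\<close>
      define L where "L = n - Suc \<delta>"
      define Y where "Y r = E $$ (r, Suc (r + \<delta>)) - E' $$ (r, Suc (r + \<delta>))" for r
      define del where "del j = take j W @ True # drop (Suc (j + \<delta>)) W" for j
      define h where "h w = (if length w = L then F w - (- 1) ^ length w * F (rev w) else 0)" for w
      have null_h: "lie_null h"
        unfolding h_def[abs_def] F_def[abs_def] by (rule lie_null_antisym[OF null])
      have tw_h: "twisted h" unfolding h_def[abs_def] by (rule twisted_antisym)
      have h: "h w = (\<Sum>j<L. if w = del j then Y j else 0)" if "length w = L" for w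
      proof -
        have "word_mat n (\<lambda>x. if x then E else D) w $$ (0, n - 1)
            - word_mat n (\<lambda>x. if x then E' else D) w $$ (0, n - 1)
          = (\<Sum>j<length w. if w = take j (drop 0 W) @ True # drop (Suc (0 + j + \<delta>)) W
            then (if True then E else D) $$ (0 + j, Suc (0 + j + \<delta>))
              - (if True then E' else D) $$ (0 + j, Suc (0 + j + \<delta>)) else 0)"
        proof (rule word_mat_diff_diag[OF M M'])
          show "(if x then E else D) $$ (r, c) = (if x then E' else D) $$ (r, c)"
            if "r < n" "c < n" "c < Suc (r + \<delta>)" for x r c
          proof (cases "c \<le> r")
            case True
            then show ?thesis using that E_low E'_low by simp
          next
            case False
            then have "c - Suc r < \<delta>" "Suc (r + (c - Suc r)) = c" using that by auto
            then show ?thesis using less.IH[of "c - Suc r"] that by metis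
          qed
          show "Suc (0 + length w + \<delta>) = n" using that \<delta> by (simp add: L_def)
        qed (use W(1) D E_low E'_low E_super E'_super in auto)
        then show ?thesis using that unfolding F' h_def F_def Y_def del_def by (simp cong: if_cong)
      qed
      have Y_one: "\<exists>!i. j \<le> i \<and> i \<le> j + \<delta> \<and> W ! i" if "Y j \<noteq> 0" "j < L" for j
      proof -
        have "E $$ (j, Suc (j + \<delta>)) \<noteq> 0 \<or> E' $$ (j, Suc (j + \<delta>)) \<noteq> 0"
          using that(1) unfolding Y_def by auto
        moreover have "j < n" "Suc (j + \<delta>) < n" using that(2) unfolding L_def by auto
        ultimately show ?thesis
          using E_one[of j "Suc (j + \<delta>)"] E'_one[of j "Suc (j + \<delta>)"]
          by (simp only: less_Suc_eq_le) blast
      qed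
      obtain m where m: "m \<noteq> []" "enc m = W" using enc_surj by blast
      have "rev m = m" using enc_inj[of "rev m" m] m W(2) by (simp add: enc_rev)
      have "even (length (enc m))" using W(1) \<open>odd n\<close> m(2) by (metis even_Suc)
      have supp: "t \<in> enc ` fam \<delta> m" if "h t \<noteq> 0" for t
      proof -
        have len: "length t = L" using that unfolding h_def by (auto split: if_splits)
        have "\<exists>j<L. t = del j \<and> Y j \<noteq> 0"
        proof (rule ccontr)
          assume "\<not> (\<exists>j<L. t = del j \<and> Y j \<noteq> 0)"
          then have "h t = 0" unfolding h[OF len] by (intro sum.neutral) auto
          with that show False ..
        qed
        then obtain j where j: "j < L" "t = del j" "Y j \<noteq> 0" by blast
        have "j + \<delta> < length W" using j(1) W(1) unfolding L_def by simp
        from unique_True_replicate[OF Y_one[OF j(3,1)] this] obtain p q where pq: "p + q = \<delta>"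
          and Wj: "W = take j W @ replicate p False @ True # replicate q False @ drop (Suc (j + \<delta>)) W" .
        obtain u0 where u0: "u0 \<noteq> []" "enc u0 = take j W" using enc_surj by blast
        obtain u a where u: "enc (u @ [a]) = take j W"
          using u0 by (cases u0 rule: rev_cases) blast+
        obtain v0 where v0: "v0 \<noteq> []" "enc v0 = drop (Suc (j + \<delta>)) W" using enc_surj by blast
        obtain b v where v: "enc (b # v) = drop (Suc (j + \<delta>)) W"
          using v0 by (cases v0) blast+
        have "enc m = enc (u @ [a]) @ replicate p False @ True # replicate q False @ enc (b # v)"
          unfolding m(2) u v by (rule Wj)
        also have "\<dots> = enc ((u @ [a + p]) @ ((b + q) # v))"
          by (subst enc_append) (simp_all add: enc_add_hd add.commute flip: enc_add_last)
        finally have "m = u @ [a + p, b + q] @ v" using enc_inj[OF m(1)] by simp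
        then have "u @ [a, b] @ v \<in> fam \<delta> m" using pq by (rule famI)
        moreover have "t = enc (u @ [a, b] @ v)"
        proof -
          have "enc ((u @ [a]) @ (b # v)) = enc (u @ [a]) @ True # enc (b # v)"
            by (rule enc_append) simp_all
          then show ?thesis unfolding j(2) del_def u v by simp
        qed
        ultimately show ?thesis by blast
      qed
      have h0: "h t = 0" for t
        by (rule fam_lie_null_zero[OF m(1) \<open>rev m = m\<close> \<open>even (length (enc m))\<close> \<delta>(1) null_h tw_h supp])
      \<comment> \<open>Two windows may give the same word. Then \<open>delete_eq_gap\<close> makes
        \<open>j\<close> and \<open>j' + \<delta>\<close> consecutive places of E in W, which is the
        situation of \<open>E_norm\<close>.\<close>
      have Y_eq: "Y j' = Y j" if "j < L" "j' < L" "del j = del j'" "Y j \<noteq> 0 \<or> Y j' \<noteq> 0" "j < j'" for j j'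
      proof -
        have len: "j' + \<delta> < length W" using that(2) W(1) unfolding L_def by simp
        have "(\<exists>!i. j \<le> i \<and> i \<le> j + \<delta> \<and> W ! i) \<or> (\<exists>!i. j' \<le> i \<and> i \<le> j' + \<delta> \<and> W ! i)"
          using that(4) Y_one[OF _ that(1)] Y_one[OF _ that(2)] by blast
        note gap = delete_eq_gap[OF that(3)[unfolded del_def] that(5) len this \<delta>(1)]
        have lt: "j + \<delta> < j' + \<delta>" "Suc (j' + \<delta>) < n" using that(5) len W(1) by auto
        show ?thesis
          using E_norm[OF lt gap] E'_norm[OF lt gap] unfolding Y_def by simp
      qed
      have "Y j = 0" if "j < L" for j
      proof (rule ccontr)
        assume Yj: "Y j \<noteq> 0"
        define J where "J = {i. i < L \<and> del j = del i}"
        have fin: "finite J" by (simp add: J_def)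
        have "length (del j) = L" using that W(1) unfolding del_def L_def by simp
        \<comment> \<open>The value of \<open>h\<close> at \<open>del j\<close> adds up over all
          windows with this result, hence equals \<open>card J\<close> times
          \<open>Y j\<close>.\<close>
        then have "0 = (\<Sum>i<L. if del j = del i then Y i else 0)" using h h0 by metis
        also have "\<dots> = (\<Sum>i\<in>J. Y i)"
          unfolding J_def by (subst sum.inter_filter[symmetric]) (auto intro!: sum.cong)
        also have "\<dots> = (\<Sum>i\<in>J. Y j)"
        proof (rule sum.cong)
          fix i assume "i \<in> J"
          then have i: "i < L" "del j = del i" by (auto simp: J_def)
          show "Y i = Y j"
          proof (rule linorder_cases[of i j])
            show "i < j \<Longrightarrow> Y i = Y j" using Y_eq[of i j] i that Yj by simp
            show "j < i \<Longrightarrow> Y i = Y j" using Y_eq[of j i] i that Yj by simp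
          qed simp
        qed simp
        also have "\<dots> = of_nat (card J) * Y j" by simp
        finally have "card J = 0" using Yj by simp
        moreover have "j \<in> J" using that by (simp add: J_def)
        ultimately show False using fin by auto
      qed
      then show ?thesis unfolding Y_def L_def by (simp add: less_diff_conv)
    qed
  qed
  have "E' = E"
  proof (rule eq_matI)
    fix r c assume "r < dim_row E" "c < dim_col E"
    then have rc: "r < n" "c < n" using carr by auto
    show "E' $$ (r, c) = E $$ (r, c)"
    proof (cases "c \<le> r")
      case True
      then show ?thesis using rc E_low E'_low by simp
    next
      case False
      then have "Suc (r + (c - Suc r)) = c" by simp
      then show ?thesis using main[of "c - Suc r"] rc by metis
    qed
  qed (use carr in \<open>auto simp: E'_def\<close>)
  then show ?thesis by (simp add: E'_def)
qed

section \<open>The matrices of the sequence\<close>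

lemma jordan_matrix_nilpotent_index:
  assumes "i < length xs" "a < xs ! i" "j < length xs" "b < xs ! j"
  shows "jordan_matrix (map (\<lambda>n. (n, 0)) xs) $$ (sum_list (take i xs) + a, sum_list (take j xs) + b)
    = (if i = j \<and> b = Suc a then 1 else 0 :: 'a::field)"
  using assms
proof (induction xs arbitrary: i j)
  case (Cons n xs)
  let ?J = "jordan_matrix (map (\<lambda>n. (n, 0 :: 'a)) xs)"
  have dim: "dim_row ?J = sum_list xs" "dim_col ?J = sum_list xs"
    by (simp_all add: comp_def)
  have J: "jordan_matrix (map (\<lambda>n. (n, 0 :: 'a)) (n # xs))
      = four_block_mat (jordan_block n 0) (0\<^sub>m n (sum_list xs)) (0\<^sub>m (sum_list xs) n) ?J"
    using dim by (simp add: jordan_matrix_def Let_def)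
  have bound: "sum_list (take i xs) + a < sum_list xs" if "i < length xs" "a < xs ! i" for i a
  proof -
    have "sum_list xs = sum_list (take i xs) + (xs ! i + sum_list (drop (Suc i) xs))"
      using that(1) by (metis id_take_nth_drop sum_list.Cons sum_list_append)
    then show ?thesis using that(2) by simp
  qed
  show ?case
  proof (cases i; cases j)
    assume "i = 0" "j = 0"
    then show ?thesis using Cons.prems unfolding J by (simp add: dim comp_def)
  next
    fix j' assume "i = 0" "j = Suc j'"
    then show ?thesis using Cons.prems bound[of j' b] unfolding J by (simp add: dim comp_def)
  next
    fix i' assume "i = Suc i'" "j = 0"
    then show ?thesis using Cons.prems bound[of i' a] unfolding J by (simp add: dim comp_def)
  next
    fix i' j' assume ij: "i = Suc i'" "j = Suc j'"
    then show ?thesis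
      using Cons.prems Cons.IH[of i' j'] bound[of i' a] bound[of j' b] unfolding J by (simp add: dim comp_def)
  qed
qed simp

lemma offset_sum_list:
  assumes "1 \<le> p" "p \<le> k + 1"
  shows "offset d p = sum_list (take (p - 1) (map d [1..<k + 1]))"
proof -
  have "take (p - 1) (map d [1..<k + 1]) = map d [1..<p]"
    using assms by (simp add: take_map take_upt del: upt_Suc)
  then show ?thesis by (simp add: offset_def sum_list_distinct_conv_sum_set del: upt_Suc)
qed

lemma dim_total_eq_offset: "dim_total k d = offset d (k + 1)"
  by (simp add: dim_total_def offset_def atLeastLessThanSuc_atLeastAtMost)

lemma D00_block:
  assumes "p \<in> {1..k}" "q \<in> {1..k}" "a < d p" "b < d q"
  shows "(D00 k d :: 'a::field mat) $$ (offset d p + a, offset d q + b) = (if p = q \<and> b = Suc a then 1 else 0)"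
proof -
  define xs where "xs = map d [1..<k + 1]"
  have "(D00 k d :: 'a mat) = jordan_matrix (map (\<lambda>n. (n, 0)) xs)"
    by (simp add: D00_def comp_def xs_def del: upt_Suc)
  moreover have "offset d p = sum_list (take (p - 1) xs)" "offset d q = sum_list (take (q - 1) xs)"
    unfolding xs_def by (rule offset_sum_list; use assms in simp)+
  moreover have "p - 1 < length xs" "xs ! (p - 1) = d p" "q - 1 < length xs" "xs ! (q - 1) = d q"
    using assms(1,2) by (auto simp: xs_def simp del: upt_Suc)
  moreover have "p - 1 = q - 1 \<longleftrightarrow> p = q" using assms(1,2) by auto
  ultimately show ?thesis
    using jordan_matrix_nilpotent_index[of "p - 1" xs a "q - 1" b] assms(3,4) by simp
qed

lemma D00_carrier: "D00 k d \<in> carrier_mat (dim_total k d) (dim_total k d)"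
proof -
  have "sum_list (map d [1..<k + 1]) = dim_total k d"
    by (simp add: dim_total_def sum_list_distinct_conv_sum_set atLeastLessThanSuc_atLeastAtMost
        del: upt_Suc)
  then show ?thesis
    using jordan_matrix_carrier[of "map (\<lambda>i. (d i, 0)) [1..<k + 1]"] by (simp add: D00_def comp_def del: upt_Suc)
qed

lemma E_mat_carrier: "E_mat k d S \<in> carrier_mat (dim_total k d) (dim_total k d)"
  by (simp add: E_mat_def)

lemma block_index:
  assumes "r < dim_total k d"
  obtains p a where "p \<in> {1..k}" "a < d p" "r = offset d p + a"
proof -
  have "\<exists>p a. p \<in> {1..k} \<and> a < d p \<and> r = offset d p + a"
    using assms
  proof (induction k)
    case (Suc k)
    show ?case
    proof (cases "r < dim_total k d")
      case True
      then show ?thesis using Suc.IH by fastforce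
    next
      case False
      then have "r - offset d (Suc k) < d (Suc k)" "r = offset d (Suc k) + (r - offset d (Suc k))"
        using Suc.prems offset_Suc[of "Suc k" d] by (auto simp: dim_total_eq_offset)
      then show ?thesis by (intro exI[of _ "Suc k"] exI[of _ "r - offset d (Suc k)"]) auto
    qed
  qed (simp add: dim_total_def)
  then show thesis using that by blast
qed

text \<open>The palindrome W: \<open>True\<close> marks the rows where a block ends and another
  follows. There E(S) carries the superdiagonal 1, elsewhere D(0,0) does.\<close>

definition boundary_word :: "nat \<Rightarrow> (nat \<Rightarrow> nat) \<Rightarrow> bool list" where
  "boundary_word k d = map (\<lambda>r. block_of d (Suc r) \<noteq> block_of d r) [0..<dim_total k d - 1]"

locale blocks =
  fixes k :: nat and d :: "nat \<Rightarrow> nat" and S :: "nat \<Rightarrow> 'a::field_char_0 mat"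
  assumes k3: "k \<ge> 3" and pos: "\<forall>i\<in>{1..k}. d i > 0" and sym: "odd_symmetric k d"
    and wn: "weakly_normalized k d S"
begin

abbreviation "n \<equiv> dim_total k d"
abbreviation "W \<equiv> boundary_word k d"

lemma W_block:
  assumes "p \<in> {1..k}" "a < d p" "Suc (offset d p + a) < n"
  shows "W ! (offset d p + a) \<longleftrightarrow> Suc a = d p"
proof -
  have 1: "block_of d (offset d p + a) = p" using assms by (intro block_of_offset) auto
  have 2: "W ! (offset d p + a) \<longleftrightarrow> block_of d (Suc (offset d p + a)) \<noteq> block_of d (offset d p + a)"
  proof -
    have "offset d p + a < n - 1" using assms(3) by simp
    then show ?thesis by (simp add: boundary_word_def)
  qed
  show ?thesis
  proof (cases "Suc a = d p")
    case True
    then have 3: "Suc (offset d p + a) = offset d (Suc p) + 0" using assms(1) offset_Suc[of p d] by simp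
    have "Suc p \<le> k"
    proof (rule ccontr)
      assume "\<not> Suc p \<le> k"
      then have "Suc p = k + 1" using assms(1) by simp
      then show False using 3 assms(3) by (simp add: dim_total_eq_offset)
    qed
    then have "block_of d (offset d (Suc p) + 0) = Suc p" using pos by (intro block_of_offset) auto
    then show ?thesis using 1 2 3 True by simp
  next
    case False
    then have "block_of d (offset d p + Suc a) = p" using assms by (intro block_of_offset) auto
    then show ?thesis using 1 2 False by simp
  qed
qed

lemma d_sym: "i \<in> {1..k} \<Longrightarrow> d (k + 1 - i) = d i"
  using sym unfolding odd_symmetric_def by metis

text \<open>Reversing the indices exchanges blocks \<open>p\<close> and \<open>k + 1 - p\<close>, so
  the rows after block \<open>p\<close> are as many as those before its mirror image.\<close>

lemma offset_flip:
  assumes "p \<in> {1..k}"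
  shows "offset d p + d p + offset d (k + 1 - p) = n"
proof -
  have "offset d (k + 1 - p) = (\<Sum>i\<in>{1..<k + 1 - p}. d (k + 1 - i))"
    unfolding offset_def by (rule sum.cong[OF refl], rule d_sym[symmetric]) (use assms in auto)
  also have "\<dots> = (\<Sum>i\<in>{Suc p..k}. d i)"
    by (rule sum.reindex_bij_witness[where i = "\<lambda>i. k + 1 - i" and j = "\<lambda>i. k + 1 - i"])
      (use assms in auto)
  finally have "offset d (k + 1 - p) = (\<Sum>i\<in>{Suc p..k}. d i)" .
  moreover have "n = offset d (Suc p) + (\<Sum>i\<in>{Suc p..k}. d i)"
  proof -
    have "{1..k} = {1..<Suc p} \<union> {Suc p..k}" using assms by auto
    moreover have "sum d ({1..<Suc p} \<union> {Suc p..k}) = sum d {1..<Suc p} + sum d {Suc p..k}"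
      by (rule sum.union_disjoint) auto
    ultimately show ?thesis unfolding dim_total_def offset_def by (simp only:)
  qed
  ultimately show ?thesis using offset_Suc[of p d] assms by simp
qed

text \<open>The middle block is its own mirror image, so \<open>n\<close> is twice its offset plus
  its odd size.\<close>

lemma odd_n: "odd n"
proof -
  define c where "c = (k + 1) div 2"
  have "odd k" "odd (d c)" using sym by (auto simp: odd_symmetric_def c_def)
  moreover from this have "k + 1 - c = c" unfolding c_def by presburger
  moreover have "c \<in> {1..k}" using k3 unfolding c_def by auto
  ultimately have "offset d c + d c + offset d c = n" using offset_flip[of c] by simp
  then have "n = 2 * offset d c + d c" by simp
  then show ?thesis using \<open>odd (d c)\<close> by simp
qed

lemma n3: "n \<ge> 3"
proof -
  have "(\<Sum>i\<in>{1..k}. 1) \<le> n"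
    unfolding dim_total_def using pos by (intro sum_mono) (auto simp: Suc_le_eq)
  then show ?thesis using k3 by simp
qed

lemma length_W: "Suc (length W) = n"
  using n3 by (simp add: boundary_word_def)

lemma rev_W: "rev W = W"
proof (rule nth_equalityI)
  fix r assume "r < length (rev W)"
  then have r: "Suc r < n" using length_W by simp
  then obtain p a where p: "p \<in> {1..k}" "a < d p" "r = offset d p + a"
    by (metis Suc_lessD block_index)
  define p' where "p' = k + 1 - p"
  have p': "p' \<in> {1..k}" "d p' = d p" using p(1) d_sym[OF p(1)] by (auto simp: p'_def)
  have fl: "offset d p + d p + offset d p' = n" unfolding p'_def using p(1) by (rule offset_flip)
  have "W ! (n - Suc (Suc r)) \<longleftrightarrow> Suc a = d p"
  proof (cases "Suc a = d p")
    case True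
    \<comment> \<open>The mirrored place is the last row of the block before \<open>p'\<close>. Such
      a block exists because \<open>r\<close> is not the last row of the matrix.\<close>
    then have eq: "n - Suc r = offset d p'" "n - Suc (Suc r) = offset d p' - 1" using fl p(3) by auto
    moreover have "offset d p' \<noteq> 0" using eq(1) r by simp
    then have "p' \<noteq> 1" by (auto simp: offset_def)
    then have q: "p' - 1 \<in> {1..k}" "Suc (p' - 1) = p'" using p'(1) by auto
    then have "offset d p' = offset d (p' - 1) + d (p' - 1)" "d (p' - 1) > 0"
      using offset_Suc[of "p' - 1" d] pos by auto
    then have "n - Suc (Suc r) = offset d (p' - 1) + (d (p' - 1) - 1)" using eq by simp
    moreover have "Suc (n - Suc (Suc r)) < n" using r by simp
    ultimately show ?thesis using W_block[OF q(1), of "d (p' - 1) - 1"] True \<open>d (p' - 1) > 0\<close> by simp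
  next
    case False
    then have "n - Suc (Suc r) = offset d p' + (d p - Suc (Suc a))" using fl p(2,3) by simp
    moreover have "Suc (n - Suc (Suc r)) < n" using r by simp
    ultimately show ?thesis using W_block[OF p'(1), of "d p - Suc (Suc a)"] False p(2) p'(2) by simp
  qed
  moreover have "rev W ! r = W ! (n - Suc (Suc r))"
  proof -
    have "length W - Suc r = n - Suc (Suc r)" using length_W by simp
    then show ?thesis using r length_W by (subst rev_nth) auto
  qed
  moreover have "W ! r \<longleftrightarrow> Suc a = d p" using W_block[OF p(1,2)] r p(3) by simp
  ultimately show "rev W ! r = W ! r" by simp
qed simp

lemma D_index:
  assumes "r < n" "c < n"
  shows "D00 k d $$ (r, c) = (if c = Suc r \<and> \<not> W ! r then 1 else 0)"
proof -
  obtain p a where p: "p \<in> {1..k}" "a < d p" "r = offset d p + a" using block_index[OF assms(1)] .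
  obtain q b where q: "q \<in> {1..k}" "b < d q" "c = offset d q + b" using block_index[OF assms(2)] .
  have "p = q \<and> b = Suc a \<longleftrightarrow> c = Suc r \<and> \<not> W ! r"
  proof
    assume "p = q \<and> b = Suc a"
    then show "c = Suc r \<and> \<not> W ! r" using W_block[OF p(1,2)] p q assms by auto
  next
    assume c: "c = Suc r \<and> \<not> W ! r"
    then have "Suc a \<noteq> d p" using W_block[OF p(1,2)] p(3) assms(2) by auto
    then have "block_of d c = p" using c p block_of_offset[of p "Suc a" d] by simp
    moreover have "block_of d c = q" using q block_of_offset[of q b d] by simp
    ultimately show "p = q \<and> b = Suc a" using c p(3) q(3) by auto
  qed
  then show ?thesis using D00_block[of p k q a d b] p q by simp
qed

lemma E_index:
  assumes "r < n" "c < n" "E_mat k d S $$ (r, c) \<noteq> 0"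
  obtains p a b where "p \<in> {1..k}" "Suc p \<in> {1..k}" "a < d p" "b < d (Suc p)"
    "r = offset d p + a" "c = offset d (Suc p) + b"
proof -
  obtain p a where p: "p \<in> {1..k}" "a < d p" "r = offset d p + a" using block_index[OF assms(1)] .
  obtain q b where q: "q \<in> {1..k}" "b < d q" "c = offset d q + b" using block_index[OF assms(2)] .
  have "q = p + 1" using E_mat_block[of p k q a d b S] p q assms(3) by (auto split: if_splits)
  then show thesis using that p q by simp
qed

text \<open>A nonzero entry leads from a row of some block \<open>p\<close> to a column of block
  \<open>p + 1\<close>, and the only block end passed on the way is that of
  \<open>p\<close>.\<close>

lemma E_one:
  assumes "r < n" "c < n" "E_mat k d S $$ (r, c) \<noteq> 0"
  shows "\<exists>!i. r \<le> i \<and> i < c \<and> W ! i"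
proof -
  obtain p a b where p: "p \<in> {1..k}" "Suc p \<in> {1..k}" "a < d p" "b < d (Suc p)"
    "r = offset d p + a" "c = offset d (Suc p) + b" using E_index[OF assms] .
  have off: "offset d (Suc p) = offset d p + d p" using offset_Suc p(1) by simp
  show ?thesis
  proof (rule ex1I[of _ "offset d p + (d p - 1)"])
    show "r \<le> offset d p + (d p - 1) \<and> offset d p + (d p - 1) < c \<and> W ! (offset d p + (d p - 1))"
      using W_block[of p "d p - 1"] p off assms(2) by auto
  next
    fix i assume i: "r \<le> i \<and> i < c \<and> W ! i"
    show "i = offset d p + (d p - 1)"
    proof (cases "i < offset d (Suc p)")
      case True
      define a' where "a' = i - offset d p"
      have a': "i = offset d p + a'" "a' < d p" using i p(5) True off by (auto simp: a'_def)
      then show ?thesis using W_block[OF p(1) a'(2)] i assms(2) by auto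
    next
      case False
      define b' where "b' = i - offset d (Suc p)"
      have b': "i = offset d (Suc p) + b'" "Suc b' \<le> b" using i p(6) False by (auto simp: b'_def)
      then show ?thesis using W_block[OF p(2), of b'] i assms(2) p(4) by auto
    qed
  qed
qed

lemma E_low:
  assumes "r < n" "c \<le> r"
  shows "E_mat k d S $$ (r, c) = 0"
proof (rule ccontr)
  assume "E_mat k d S $$ (r, c) \<noteq> 0"
  from E_one[OF assms(1) _ this] assms show False by auto
qed

lemma E_super:
  assumes "Suc r < n"
  shows "E_mat k d S $$ (r, Suc r) = (if W ! r then 1 else 0)"
proof (cases "W ! r")
  case False
  have "E_mat k d S $$ (r, Suc r) = 0"
  proof (rule ccontr)
    assume "E_mat k d S $$ (r, Suc r) \<noteq> 0"
    from E_one[OF _ assms this] assms obtain i where "r \<le> i" "i < Suc r" "W ! i" by auto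
    then show False using False by (simp add: less_Suc_eq_le)
  qed
  then show ?thesis using False by simp
next
  case True
  obtain p a where p: "p \<in> {1..k}" "a < d p" "r = offset d p + a"
    using assms by (metis Suc_lessD block_index)
  have a: "Suc a = d p" using W_block[OF p(1,2)] p(3) True assms by simp
  then have c: "Suc r = offset d (Suc p) + 0" using p offset_Suc[of p d] by simp
  have "p \<noteq> k" using c assms by (auto simp: dim_total_eq_offset)
  then have p': "Suc p \<in> {1..k}" "p \<in> {1..k - 1}" using p(1) by auto
  then have "E_mat k d S $$ (offset d p + a, offset d (Suc p) + 0) = S p $$ (a, 0)"
    using E_mat_block[of p k "Suc p" a d 0 S] p(1,2) pos by simp
  then have "E_mat k d S $$ (r, Suc r) = S p $$ (a, 0)" unfolding p(3)[symmetric] c[symmetric] .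
  moreover have "S p $$ (d p - 1, 0) = 1" using wn p'(2) by (auto simp: weakly_normalized_def)
  moreover have "d p - 1 = a" using a by simp
  ultimately show ?thesis using True by simp
qed

text \<open>Here \<open>r\<close> and \<open>s\<close> are the last rows of consecutive blocks
  \<open>p\<close> and \<open>p + 1\<close>. The two entries lie in the last row of
  \<open>S p\<close> and in the first column of \<open>S (Suc p)\<close>, where weak normalization
  (ii) identifies them.\<close>

lemma E_norm:
  assumes "r + \<delta> < s" "Suc s < n" "W ! r" "W ! s" "\<And>t. r < t \<Longrightarrow> t < s \<Longrightarrow> \<not> W ! t"
  shows "E_mat k d S $$ (r, Suc (r + \<delta>)) = E_mat k d S $$ (s - \<delta>, Suc s)"
proof -
  have "Suc r < n" "r < n" "s < n" using assms by auto
  obtain p a where p: "p \<in> {1..k}" "a < d p" "r = offset d p + a" using block_index[OF \<open>r < n\<close>] .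
  have a: "Suc a = d p" using W_block[OF p(1,2)] p(3) assms(3) \<open>Suc r < n\<close> by simp
  then have c: "Suc r = offset d (Suc p)" using p offset_Suc[of p d] by simp
  have "p \<noteq> k" using c \<open>Suc r < n\<close> by (auto simp: dim_total_eq_offset)
  then have p': "Suc p \<in> {1..k}" using p(1) by auto
  then have dp': "d (Suc p) > 0" using pos by blast
  define i where "i = offset d (Suc p) + (d (Suc p) - 1)"
  have "s = i"
  proof (rule linorder_cases[of s i])
    assume "s < i"
    define b where "b = s - offset d (Suc p)"
    have "s = offset d (Suc p) + b" "b < d (Suc p)" "Suc b \<noteq> d (Suc p)"
      using \<open>s < i\<close> assms(1) c by (auto simp: b_def i_def)
    then show ?thesis using W_block[OF p', of b] assms(2,4) by simp
  next
    assume "i < s"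
    then have "W ! i" using W_block[OF p', of "d (Suc p) - 1"] assms(2) dp' by (auto simp: i_def)
    moreover have "r < i" using c by (simp add: i_def)
    ultimately show ?thesis using assms(5) \<open>i < s\<close> by blast
  qed simp
  then have s: "Suc s = offset d (Suc (Suc p)) + 0" using offset_Suc[of "Suc p" d] dp' by (simp add: i_def)
  have "Suc p \<noteq> k" using s assms(2) by (auto simp: dim_total_eq_offset)
  then have p'': "Suc (Suc p) \<in> {1..k}" "p \<in> {1..k - 2}" using p(1) p' by auto
  have \<delta>: "\<delta> < d (Suc p)" using assms(1) c \<open>s = i\<close> dp' by (auto simp: i_def)
  have 1: "E_mat k d S $$ (r, Suc (r + \<delta>)) = S p $$ (a, \<delta>)"
    using E_mat_block[of p k "Suc p" a d \<delta> S] p p' \<delta> c by (simp flip: add_Suc)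
  have "s - \<delta> = offset d (Suc p) + (d (Suc p) - 1 - \<delta>)" using \<open>s = i\<close> \<delta> by (simp add: i_def)
  then have 2: "E_mat k d S $$ (s - \<delta>, Suc s) = S (Suc p) $$ (d (Suc p) - 1 - \<delta>, 0)"
    unfolding s using E_mat_block[of "Suc p" k "Suc (Suc p)" "d (Suc p) - 1 - \<delta>" d 0 S] p' dp' pos p''(1)
    by simp
  have "entry (S p) (d p) (Suc \<delta>) = entry (S (p + 1)) (d (p + 1) + 1 - Suc \<delta>) 1"
  proof -
    have "Suc \<delta> \<in> {1..d (p + 1)}" using \<delta> by simp
    then show ?thesis using wn p''(2) unfolding weakly_normalized_def by blast
  qed
  moreover have "d p - 1 = a" using a by simp
  ultimately have "S p $$ (a, \<delta>) = S (Suc p) $$ (d (Suc p) - 1 - \<delta>, 0)" by simp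
  then show ?thesis unfolding 1 2 .
qed

end

section \<open>The Lie algebra n(S) and its stability properties\<close>

lemma phi_diff:
  assumes "A \<in> carrier_mat n n" "B \<in> carrier_mat n n"
  shows "phi n (A - B) = phi n A - phi n B"
  by (rule eq_matI) (use assms in \<open>auto simp: phi_index algebra_simps\<close>)

lemma phi_add:
  assumes "A \<in> carrier_mat n n" "B \<in> carrier_mat n n"
  shows "phi n (A + B) = phi n A + phi n B"
  by (rule eq_matI) (use assms in \<open>auto simp: phi_index algebra_simps\<close>)

lemma phi_smult:
  assumes "A \<in> carrier_mat n n"
  shows "phi n (c \<cdot>\<^sub>m A) = c \<cdot>\<^sub>m phi n A"
  by (rule eq_matI) (use assms in \<open>auto simp: phi_index algebra_simps\<close>)

lemma phi_zero: "phi n (0\<^sub>m n n) = 0\<^sub>m n n"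
  by (rule eq_matI) (auto simp: phi_index)

lemma lie_bracket_carrier:
  "A \<in> carrier_mat n n \<Longrightarrow> B \<in> carrier_mat n n \<Longrightarrow> lie_bracket A B \<in> carrier_mat n n"
  unfolding lie_bracket_def by (rule minus_carrier_mat[OF mult_carrier_mat])

lemma phi_lie_bracket:
  fixes A B :: "'a::field mat"
  assumes "A \<in> carrier_mat n n" "B \<in> carrier_mat n n"
  shows "phi n (lie_bracket A B) = lie_bracket (phi n A) (phi n B)"
proof -
  have "A * B \<in> carrier_mat n n" "B * A \<in> carrier_mat n n"
    using mult_carrier_mat assms by blast+
  then have "phi n (lie_bracket A B) = - (phi n B * phi n A) - - (phi n A * phi n B)"
    using assms by (simp add: lie_bracket_def phi_diff phi_mult)
  moreover have "phi n A * phi n B \<in> carrier_mat n n" "phi n B * phi n A \<in> carrier_mat n n"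
    using mult_carrier_mat phi_carrier by blast+
  then have "- (phi n B * phi n A) - - (phi n A * phi n B) = lie_bracket (phi n A) (phi n B)"
    unfolding lie_bracket_def by (intro eq_matI) auto
  ultimately show ?thesis by simp
qed

lemma add_diff_add_mat:
  fixes A :: "'a::ab_group_add mat"
  assumes "A \<in> carrier_mat n m" "B \<in> carrier_mat n m" "C \<in> carrier_mat n m" "D \<in> carrier_mat n m"
  shows "(A + B) - (C + D) = (A - C) + (B - D)"
  by (rule eq_matI) (use assms in auto)

lemma smult_diff_mat:
  fixes A :: "'a::ring mat"
  assumes "A \<in> carrier_mat n m" "B \<in> carrier_mat n m"
  shows "c \<cdot>\<^sub>m A - c \<cdot>\<^sub>m B = c \<cdot>\<^sub>m (A - B)"
  by (rule eq_matI) (use assms in \<open>auto simp: algebra_simps\<close>)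

lemma diff_swap_mat:
  fixes A :: "'a::ring_1 mat"
  assumes "A \<in> carrier_mat n m" "B \<in> carrier_mat n m"
  shows "A - B = - 1 \<cdot>\<^sub>m (B - A)"
  by (rule eq_matI) (use assms in auto)

lemma lie_bracket_derivation:
  fixes D :: "'a::field mat"
  assumes D: "D \<in> carrier_mat n n" and A: "A \<in> carrier_mat n n" and B: "B \<in> carrier_mat n n"
  shows "lie_bracket D (lie_bracket A B)
    = lie_bracket (lie_bracket D A) B + lie_bracket A (lie_bracket D B)"
proof -
  have arrange: "(a - b) - (c - d) = ((a - e) - (f - d)) + ((e - c) - (b - f))"
    if "a \<in> carrier_mat n n" "b \<in> carrier_mat n n" "c \<in> carrier_mat n n"
      "d \<in> carrier_mat n n" "e \<in> carrier_mat n n" "f \<in> carrier_mat n n"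
    for a b c d e f :: "'a mat"
    by (rule eq_matI) (use that in auto)
  have left: "X * (Y * Z - Z * Y) = X * Y * Z - X * Z * Y"
    and right: "(Y * Z - Z * Y) * X = Y * Z * X - Z * Y * X"
    if "X \<in> carrier_mat n n" "Y \<in> carrier_mat n n" "Z \<in> carrier_mat n n" for X Y Z :: "'a mat"
  proof -
    have c: "Y * Z \<in> carrier_mat n n" "Z * Y \<in> carrier_mat n n"
      using mult_carrier_mat that by blast+
    show "X * (Y * Z - Z * Y) = X * Y * Z - X * Z * Y"
      unfolding mult_minus_distrib_mat[OF that(1) c]
      by (simp only: assoc_mult_mat[OF that(1,2,3)] assoc_mult_mat[OF that(1,3,2)])
    show "(Y * Z - Z * Y) * X = Y * Z * X - Z * Y * X"
      using c that(1) by (rule minus_mult_distrib_mat)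
  qed
  have triple: "X * Y * Z \<in> carrier_mat n n"
    if "X \<in> carrier_mat n n" "Y \<in> carrier_mat n n" "Z \<in> carrier_mat n n" for X Y Z :: "'a mat"
    using mult_carrier_mat[OF mult_carrier_mat[OF that(1,2)] that(3)] .
  show ?thesis
    unfolding lie_bracket_def
      left[OF D A B] right[OF D A B] left[OF B D A] right[OF B D A] left[OF A D B] right[OF A D B]
    by (rule arrange) (rule triple; fact)+
qed

lemma lie_bracket_add_right:
  fixes D :: "'a::field mat"
  assumes "D \<in> carrier_mat n n" "A \<in> carrier_mat n n" "B \<in> carrier_mat n n"
  shows "lie_bracket D (A + B) = lie_bracket D A + lie_bracket D B"
proof -
  have "D * (A + B) = D * A + D * B" "(A + B) * D = A * D + B * D"
    using mult_add_distrib_mat[OF assms] add_mult_distrib_mat[OF assms(2,3,1)] by auto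
  moreover have "D * A \<in> carrier_mat n n" "D * B \<in> carrier_mat n n"
    "A * D \<in> carrier_mat n n" "B * D \<in> carrier_mat n n"
    using mult_carrier_mat assms by blast+
  ultimately show ?thesis unfolding lie_bracket_def by (simp only: add_diff_add_mat)
qed

lemma lie_bracket_smult_right:
  fixes D :: "'a::field mat"
  assumes "D \<in> carrier_mat n n" "A \<in> carrier_mat n n"
  shows "lie_bracket D (c \<cdot>\<^sub>m A) = c \<cdot>\<^sub>m lie_bracket D A"
proof -
  have "D * (c \<cdot>\<^sub>m A) = c \<cdot>\<^sub>m (D * A)" "(c \<cdot>\<^sub>m A) * D = c \<cdot>\<^sub>m (A * D)"
    using mult_smult_distrib[OF assms] mult_smult_assoc_mat[OF assms(2,1)] by auto
  moreover have "D * A \<in> carrier_mat n n" "A * D \<in> carrier_mat n n"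
    using mult_carrier_mat assms by blast+
  ultimately show ?thesis unfolding lie_bracket_def by (simp only: smult_diff_mat)
qed

lemma lie_bracket_anticomm:
  fixes A B :: "'a::field mat"
  assumes "A \<in> carrier_mat n n" "B \<in> carrier_mat n n"
  shows "lie_bracket A B = - 1 \<cdot>\<^sub>m lie_bracket B A"
proof -
  have "A * B \<in> carrier_mat n n" "B * A \<in> carrier_mat n n"
    using mult_carrier_mat assms by blast+
  then show ?thesis unfolding lie_bracket_def by (rule diff_swap_mat)
qed

lemma lie_bracket_self: "A \<in> carrier_mat n n \<Longrightarrow> lie_bracket A A = 0\<^sub>m n n"
  unfolding lie_bracket_def by (rule minus_r_inv_mat[OF mult_carrier_mat])

lemma lie_bracket_zero_right:
  fixes A :: "'a::field mat"
  shows "A \<in> carrier_mat n n \<Longrightarrow> lie_bracket A (0\<^sub>m n n) = 0\<^sub>m n n"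
  by (simp add: lie_bracket_def minus_r_inv_mat[OF zero_carrier_mat])

lemma n_alg_generator: "(lie_bracket (D00 k d) ^^ l) (E_mat k d S) \<in> n_alg k d S"
  unfolding n_alg_def by (rule hull_inc) blast

lemma n_alg_subset:
  assumes "lie_subalgebra (dim_total k d) L"
    and "\<And>l. (lie_bracket (D00 k d) ^^ l) (E_mat k d S) \<in> L"
  shows "n_alg k d S \<subseteq> L"
  unfolding n_alg_def
  by (rule hull_minimal[where S = "lie_subalgebra (dim_total k d)", OF _ assms(1)])
    (use assms(2) in blast)

lemma generator_carrier:
  "(lie_bracket (D00 k d) ^^ l) (E_mat k d S) \<in> carrier_mat (dim_total k d) (dim_total k d)"
  by (induction l) (simp_all add: lie_bracket_carrier D00_carrier E_mat_carrier)

lemma lie_subalgebra_n_alg: "lie_subalgebra (dim_total k d) (n_alg k d S)"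
proof -
  let ?n = "dim_total k d"
  have "lie_subalgebra ?n (carrier_mat ?n ?n :: 'a mat set)"
    unfolding lie_subalgebra_def by (auto intro: lie_bracket_carrier)
  then have "n_alg k d S \<subseteq> carrier_mat ?n ?n"
    using generator_carrier by (rule n_alg_subset)
  moreover have "0\<^sub>m ?n ?n \<in> n_alg k d S"
    unfolding n_alg_def hull_def by (auto simp: lie_subalgebra_def)
  moreover have "A + B \<in> n_alg k d S" "lie_bracket A B \<in> n_alg k d S"
    if "A \<in> n_alg k d S" "B \<in> n_alg k d S" for A B
    using that unfolding n_alg_def hull_def by (auto simp: lie_subalgebra_def)
  moreover have "c \<cdot>\<^sub>m A \<in> n_alg k d S" if "A \<in> n_alg k d S" for c A
    using that unfolding n_alg_def hull_def by (auto simp: lie_subalgebra_def)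
  ultimately show ?thesis unfolding lie_subalgebra_def by blast
qed

text \<open>The elements of n(S) that ad D(0,0) maps into n(S) form a subalgebra by the Jacobi
  identity. It contains the generators, since ad D(0,0) only raises their index l.\<close>

lemma n_alg_D00_bracket:
  assumes "A \<in> n_alg k d S"
  shows "lie_bracket (D00 k d) A \<in> n_alg k d S"
proof -
  let ?n = "dim_total k d" and ?D = "D00 k d"
  define L where "L = {A \<in> n_alg k d S. lie_bracket ?D A \<in> n_alg k d S}"
  note sub = lie_subalgebra_n_alg[of k d S, unfolded lie_subalgebra_def]
  have carr: "A \<in> carrier_mat ?n ?n" if "A \<in> n_alg k d S" for A using sub that by blast
  have "lie_subalgebra ?n L"
    unfolding lie_subalgebra_def
  proof (intro conjI ballI allI)
    show "L \<subseteq> carrier_mat ?n ?n" using carr by (auto simp: L_def)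
    show "0\<^sub>m ?n ?n \<in> L" using sub by (simp add: L_def lie_bracket_zero_right[OF D00_carrier])
    fix A B assume "A \<in> L" "B \<in> L"
    then have AB: "A \<in> n_alg k d S" "lie_bracket ?D A \<in> n_alg k d S"
      "B \<in> n_alg k d S" "lie_bracket ?D B \<in> n_alg k d S" by (auto simp: L_def)
    show "A + B \<in> L" using AB sub
      by (simp add: L_def lie_bracket_add_right[OF D00_carrier carr carr])
    show "lie_bracket A B \<in> L" using AB sub
      by (simp add: L_def lie_bracket_derivation[OF D00_carrier carr carr])
  next
    fix c A assume "A \<in> L"
    then show "c \<cdot>\<^sub>m A \<in> L" using sub
      by (simp add: L_def lie_bracket_smult_right[OF D00_carrier carr])
  qed
  moreover have "(lie_bracket ?D ^^ l) (E_mat k d S) \<in> L" for l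
    using n_alg_generator[of l k d S] n_alg_generator[of "Suc l" k d S] by (simp add: L_def)
  ultimately show ?thesis using n_alg_subset[of k d L S] assms by (auto simp: L_def)
qed

lemma phi_fixes_n_alg:
  assumes D: "phi (dim_total k d) (D00 k d :: 'a::field mat) = D00 k d"
    and E: "phi (dim_total k d) (E_mat k d S :: 'a mat) = E_mat k d S"
    and "A \<in> n_alg k d S"
  shows "phi (dim_total k d) A = A"
proof -
  let ?n = "dim_total k d"
  define L where "L = {A \<in> carrier_mat ?n ?n. phi ?n A = (A :: 'a mat)}"
  have "lie_subalgebra ?n L"
    unfolding lie_subalgebra_def L_def
    by (auto simp: phi_zero phi_add phi_smult phi_lie_bracket intro: lie_bracket_carrier)
  moreover have "(lie_bracket (D00 k d) ^^ l) (E_mat k d S) \<in> L" for l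
  proof (induction l)
    case 0
    then show ?case using E E_mat_carrier by (auto simp: L_def)
  next
    case (Suc l)
    then show ?case using D D00_carrier
      by (auto simp: L_def phi_lie_bracket intro!: lie_bracket_carrier)
  qed
  ultimately show ?thesis using n_alg_subset[of k d L S] assms(3) by (auto simp: L_def)
qed

theorem proposition3p16:
  fixes k :: nat and d :: "nat \<Rightarrow> nat" and S :: "nat \<Rightarrow> 'a::field_char_0 mat"
  assumes "k \<ge> 3" and "odd k"
    and "\<forall>i\<in>{1..k}. d i > 0"
    and "odd_symmetric k d"
    and "\<forall>i\<in>{1..k - 1}. S i \<in> carrier_mat (d i) (d (i + 1))"
    and "\<forall>i\<in>{1..k - 1}. entry (S i) (d i) 1 \<noteq> 0"
    and "weakly_normalized k d S"
  shows "(\<forall>A\<in>n_alg k d S. entry A 1 (dim_total k d) = 0) \<longleftrightarrow> phi_invariant k d S"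
proof -
  interpret blocks k d S by unfold_locales (rule assms)+
  let ?D = "D00 k d :: 'a mat" and ?E = "E_mat k d S"
  have D_carr: "?D \<in> carrier_mat n n" and E_carr: "?E \<in> carrier_mat n n"
    by (rule D00_carrier E_mat_carrier)+
  show ?thesis
  proof
    assume inv: "phi_invariant k d S"
    have "phi n ?D = ?D"
      using D_carr length_W rev_W D_index by (rule phi_partial_shift)
    moreover have "phi n ?E = ?E" using inv unfolding phi_invariant_def .
    ultimately have fixed: "phi n A = A" if "A \<in> n_alg k d S" for A
      using that by (rule phi_fixes_n_alg)
    show "\<forall>A\<in>n_alg k d S. entry A 1 n = 0"
    proof
      fix A assume "A \<in> n_alg k d S"
      then have "phi n A $$ (0, n - 1) = A $$ (0, n - 1)" by (simp only: fixed)
      moreover have "phi n A $$ (0, n - 1) = (- 1) ^ n * A $$ (0, n - 1)"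
        using n3 by (simp add: phi_index)
      ultimately show "entry A 1 n = 0" using odd_n by simp
    qed
  next
    assume zero: "\<forall>A\<in>n_alg k d S. entry A 1 n = 0"
    define M where "M = (\<lambda>x. if x then ?E else ?D)"
    have M: "M x \<in> carrier_mat n n" for x using D_carr E_carr by (simp add: M_def)
    note sub = lie_subalgebra_n_alg[of k d S, unfolded lie_subalgebra_def]
    have E_mem: "?E \<in> n_alg k d S" using n_alg_generator[of 0 k d S] by simp
    \<comment> \<open>The single letter D is the only left-normed bracket that need not lie in n(S),
      whence the \<open>insert\<close>. Bracketing it once with E or D gives a generator or
      0.\<close>
    have mem: "foldr (\<lambda>x B. lie_bracket B (M x)) xs (M x) \<in> insert ?D (n_alg k d S)" for xs x
    proof (induction xs)
      case Nil
      then show ?case using E_mem by (simp add: M_def)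
    next
      case (Cons y xs)
      let ?B = "foldr (\<lambda>x B. lie_bracket B (M x)) xs (M x)"
      have "lie_bracket ?B (M y) \<in> n_alg k d S"
      proof (cases "?B = ?D")
        case True
        then show ?thesis
          using n_alg_generator[of 1 k d S] sub lie_bracket_self[OF D_carr] by (simp add: M_def)
      next
        case False
        then have B: "?B \<in> n_alg k d S" using Cons by simp
        show ?thesis
        proof (cases y)
          case True
          then show ?thesis using B E_mem sub by (simp add: M_def)
        next
          case False
          have "?B \<in> carrier_mat n n" using B sub by blast
          then have "lie_bracket ?B ?D = - 1 \<cdot>\<^sub>m lie_bracket ?D ?B"
            using D_carr by (rule lie_bracket_anticomm)
          then show ?thesis using n_alg_D00_bracket[OF B] sub False by (simp add: M_def)
        qed
      qed
      then show ?case by simp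
    qed
    have "lie_null (\<lambda>w. word_mat n M w $$ (0, n - 1))"
      unfolding lie_null_def
    proof (intro allI)
      fix xs x
      have "foldl br (\<lambda>w. word_mat n M w $$ (0, n - 1)) xs [x]
          = foldr (\<lambda>x B. lie_bracket B (M x)) xs (M x) $$ (0, n - 1)"
        using foldl_br_word_mat[of M n 0 "n - 1" xs "[x]"] M right_mult_one_mat[OF M, of x] n3 by simp
      moreover have "n - 1 \<noteq> Suc 0" "0 < n" "n - 1 < n" using n3 by auto
      \<comment> \<open>D lives on the superdiagonal, and the corner is off it because
        \<open>n\<close> is at least 3.\<close>
      then have D0: "?D $$ (0, n - 1) = 0" using D_index[of 0 "n - 1"] by simp
      moreover have "B $$ (0, n - 1) = 0" if "B \<in> insert ?D (n_alg k d S)" for B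
        using that
      proof
        assume "B = ?D"
        then show ?thesis using D0 by (simp only:)
      next
        assume "B \<in> n_alg k d S"
        with zero have "entry B 1 n = 0" by (rule bspec)
        then show ?thesis by simp
      qed
      from this[OF mem] have "foldr (\<lambda>x B. lie_bracket B (M x)) xs (M x) $$ (0, n - 1) = 0" .
      ultimately show "foldl br (\<lambda>w. word_mat n M w $$ (0, n - 1)) xs [x] = 0" by simp
    qed
    note null = this[unfolded M_def]
    have "phi n ?E = ?E"
      by (rule phi_fixed_if_lie_null[OF D_carr E_carr length_W rev_W odd_n D_index E_low E_super
            E_one E_norm null])
    then show "phi_invariant k d S" unfolding phi_invariant_def .
  qed
qed

end
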